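(* Let $\mathcal{A}$ be an essentially small abelian length category. For $\mathcal{T}\in\mathsf{tors}\,\mathcal{A}$ the following conditions are equivalent: (a) $\mathcal{T}$ is a widely generated torsion class; (b) $\mathcal{T}=\mathsf{T}(\mathsf{W}_L(\mathcal{T}))$; (c) $\mathcal{T}=\mathsf{T}(\mathcal{L})$, where $\mathcal{L}$ is the set of brick labels of Hasse arrows in $\mathsf{tors}\,\mathcal{A}$ starting at $\mathcal{T}$; (d) for every $\mathcal{U}\in\mathsf{tors}\,\mathcal{A}$ with $\mathcal{U}\subsetneq\mathcal{T}$, there exists a Hasse arrow $\mathcal{T}\to\mathcal{U}'$ in $\mathsf{tors}\,\mathcal{A}$ such that $\mathcal{U}\subseteq\mathcal{U}'$.
   Context: All subcategories are full and closed under isomorphism. An abelian length category is an abelian category in which every object has a finite composition series. For a subcategory $\mathcal{X}\subseteq\mathcal{A}$: $\mathcal{X}^\perp=\{Y\mid \mathrm{Hom}_{\mathcal{A}}(X,Y)=0\ \forall X\in\mathcal{X}\}$. A torsion class is a subcategory closed under extensions and factor objects; $\mathsf{tors}\,\mathcal{A}$ is the set of torsion classes in $\mathcal{A}$, ordered by inclusion. $\mathsf{T}(\mathcal{X})$ is the smallest torsion class of $\mathcal{A}$ containing $\mathcal{X}$. A wide subcategory is one closed under kernels, cokernels and extensions in $\mathcal{A}$. A torsion class $\mathcal{T}$ is widely generated if $\mathcal{T}=\mathsf{T}(\mathcal{W})$ for some wide subcategory $\mathcal{W}$ of $\mathcal{A}$. For $\mathcal{T}\in\mathsf{tors}\,\mathcal{A}$,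 $$\mathsf{W}_L(\mathcal{T})=\{X\in\mathcal{T}\mid\text{for all }Y\in\mathcal{T}\text{ and all }g\colon Y\to X,\ \mathrm{Ker}\,g\in\mathcal{T}\}.$$ There is a Hasse arrow $\mathcal{V}_1\to\mathcal{V}_2$ in $\mathsf{tors}\,\mathcal{A}$ iff $\mathcal{V}_2\subsetneq\mathcal{V}_1$ and no torsion class lies strictly between them. A brick is an object whose endomorphism ring is a division ring. It is known that there is a Hasse arrow $\mathcal{V}_1\to\mathcal{V}_2$ (for $\mathcal{V}_2\subseteq\mathcal{V}_1$) iff $\mathcal{V}_2^\perp\cap\mathcal{V}_1$ contains exactly one brick up to isomorphism; the isomorphism class of this brick is the brick label of the arrow. *)

theory Defs
  imports "HOL.Hull" "HOL-Algebra.Ring"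
begin

section \<open>Categories and abelian length categories\<close>

text \<open>
  Objects and morphisms are the elements of two sets. As both are sets, every category in this
  sense is small; essentially small categories are covered because they are equivalent to small
  ones. Composition is written in the usual order: \<open>g \<cdot>\<^bsub>A\<^esub> f\<close> is \<open>g\<close> after \<open>f\<close>. The values of
  the operations matter only on composable, respectively parallel, morphisms.
\<close>

record ('o, 'm) precat =
  Ob :: "'o set"
  Ar :: "'m set"
  Dom :: "'m \<Rightarrow> 'o"
  Cod :: "'m \<Rightarrow> 'o"
  Id :: "'o \<Rightarrow> 'm"
  Comp :: "'m \<Rightarrow> 'm \<Rightarrow> 'm" (infixl "\<cdot>\<index>" 70)
  Plus :: "'m \<Rightarrow> 'm \<Rightarrow> 'm"
  Null :: "'o \<Rightarrow> 'o \<Rightarrow> 'm"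

definition Hom :: "('o, 'm, 'e) precat_scheme \<Rightarrow> 'o \<Rightarrow> 'o \<Rightarrow> 'm set" where
  "Hom A X Y = {f \<in> Ar A. Dom A f = X \<and> Cod A f = Y}"

locale category =
  fixes A :: "('o, 'm, 'e) precat_scheme" (structure)
  assumes Dom_Ob: "f \<in> Ar A \<Longrightarrow> Dom A f \<in> Ob A"
    and Cod_Ob: "f \<in> Ar A \<Longrightarrow> Cod A f \<in> Ob A"
    and Id_Hom: "X \<in> Ob A \<Longrightarrow> Id A X \<in> Hom A X X"
    and Comp_Hom: "f \<in> Hom A X Y \<Longrightarrow> g \<in> Hom A Y Z \<Longrightarrow> g \<cdot> f \<in> Hom A X Z"
    and Comp_Id: "f \<in> Hom A X Y \<Longrightarrow> f \<cdot> Id A X = f"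
    and Id_Comp: "f \<in> Hom A X Y \<Longrightarrow> Id A Y \<cdot> f = f"
    and Comp_assoc: "f \<in> Hom A W X \<Longrightarrow> g \<in> Hom A X Y \<Longrightarrow> h \<in> Hom A Y Z
      \<Longrightarrow> (h \<cdot> g) \<cdot> f = h \<cdot> (g \<cdot> f)"

definition Hom_group :: "('o, 'm, 'e) precat_scheme \<Rightarrow> 'o \<Rightarrow> 'o \<Rightarrow> 'm monoid" where
  "Hom_group A X Y = \<lparr>carrier = Hom A X Y, monoid.mult = Plus A, one = Null A X Y\<rparr>"

locale preadditive_category = category +
  assumes Hom_comm_group: "X \<in> Ob A \<Longrightarrow> Y \<in> Ob A \<Longrightarrow> comm_group (Hom_group A X Y)"
    and Comp_Plus: "f \<in> Hom A X Y \<Longrightarrow> f' \<in> Hom A X Y \<Longrightarrow> g \<in> Hom A Y Z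
      \<Longrightarrow> g \<cdot> Plus A f f' = Plus A (g \<cdot> f) (g \<cdot> f')"
    and Plus_Comp: "f \<in> Hom A X Y \<Longrightarrow> g \<in> Hom A Y Z \<Longrightarrow> g' \<in> Hom A Y Z
      \<Longrightarrow> Plus A g g' \<cdot> f = Plus A (g \<cdot> f) (g' \<cdot> f)"

definition monic :: "('o, 'm, 'e) precat_scheme \<Rightarrow> 'm \<Rightarrow> bool" where
  "monic A f \<longleftrightarrow> f \<in> Ar A \<and>
    (\<forall>W. \<forall>g\<in>Hom A W (Dom A f). \<forall>h\<in>Hom A W (Dom A f). f \<cdot>\<^bsub>A\<^esub> g = f \<cdot>\<^bsub>A\<^esub> h \<longrightarrow> g = h)"

definition epic :: "('o, 'm, 'e) precat_scheme \<Rightarrow> 'm \<Rightarrow> bool" where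
  "epic A f \<longleftrightarrow> f \<in> Ar A \<and>
    (\<forall>Z. \<forall>g\<in>Hom A (Cod A f) Z. \<forall>h\<in>Hom A (Cod A f) Z. g \<cdot>\<^bsub>A\<^esub> f = h \<cdot>\<^bsub>A\<^esub> f \<longrightarrow> g = h)"

definition is_iso :: "('o, 'm, 'e) precat_scheme \<Rightarrow> 'm \<Rightarrow> bool" where
  "is_iso A f \<longleftrightarrow> f \<in> Ar A \<and>
    (\<exists>g\<in>Hom A (Cod A f) (Dom A f). g \<cdot>\<^bsub>A\<^esub> f = Id A (Dom A f) \<and> f \<cdot>\<^bsub>A\<^esub> g = Id A (Cod A f))"

definition iso_objs :: "('o, 'm, 'e) precat_scheme \<Rightarrow> 'o \<Rightarrow> 'o \<Rightarrow> bool" where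
  "iso_objs A X Y \<longleftrightarrow> (\<exists>f\<in>Hom A X Y. is_iso A f)"

definition is_kernel :: "('o, 'm, 'e) precat_scheme \<Rightarrow> 'm \<Rightarrow> 'm \<Rightarrow> bool" where
  "is_kernel A k f \<longleftrightarrow> f \<in> Ar A \<and> k \<in> Ar A \<and> Cod A k = Dom A f \<and>
    f \<cdot>\<^bsub>A\<^esub> k = Null A (Dom A k) (Cod A f) \<and>
    (\<forall>W. \<forall>h\<in>Hom A W (Dom A f). f \<cdot>\<^bsub>A\<^esub> h = Null A W (Cod A f) \<longrightarrow>
       (\<exists>!u. u \<in> Hom A W (Dom A k) \<and> k \<cdot>\<^bsub>A\<^esub> u = h))"

definition is_cokernel :: "('o, 'm, 'e) precat_scheme \<Rightarrow> 'm \<Rightarrow> 'm \<Rightarrow> bool" where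
  "is_cokernel A c f \<longleftrightarrow> f \<in> Ar A \<and> c \<in> Ar A \<and> Dom A c = Cod A f \<and>
    c \<cdot>\<^bsub>A\<^esub> f = Null A (Dom A f) (Cod A c) \<and>
    (\<forall>Z. \<forall>h\<in>Hom A (Cod A f) Z. h \<cdot>\<^bsub>A\<^esub> f = Null A (Dom A f) Z \<longrightarrow>
       (\<exists>!u. u \<in> Hom A (Cod A c) Z \<and> u \<cdot>\<^bsub>A\<^esub> c = h))"

definition zero_object :: "('o, 'm, 'e) precat_scheme \<Rightarrow> 'o \<Rightarrow> bool" where
  "zero_object A Z \<longleftrightarrow> Z \<in> Ob A \<and>
    (\<forall>X\<in>Ob A. (\<exists>!f. f \<in> Hom A X Z) \<and> (\<exists>!f. f \<in> Hom A Z X))"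

definition is_biproduct ::
    "('o, 'm, 'e) precat_scheme \<Rightarrow> 'o \<Rightarrow> 'o \<Rightarrow> 'o \<Rightarrow> 'm \<Rightarrow> 'm \<Rightarrow> 'm \<Rightarrow> 'm \<Rightarrow> bool" where
  "is_biproduct A X Y S i j p q \<longleftrightarrow>
    i \<in> Hom A X S \<and> j \<in> Hom A Y S \<and> p \<in> Hom A S X \<and> q \<in> Hom A S Y \<and>
    p \<cdot>\<^bsub>A\<^esub> i = Id A X \<and> q \<cdot>\<^bsub>A\<^esub> j = Id A Y \<and>
    Plus A (i \<cdot>\<^bsub>A\<^esub> p) (j \<cdot>\<^bsub>A\<^esub> q) = Id A S"

locale abelian_category = preadditive_category +
  assumes ex_zero_object: "\<exists>Z. zero_object A Z"
    and ex_biproduct: "X \<in> Ob A \<Longrightarrow> Y \<in> Ob A \<Longrightarrow> \<exists>S i j p q. is_biproduct A X Y S i j p q"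
    and ex_kernel: "f \<in> Ar A \<Longrightarrow> \<exists>k. is_kernel A k f"
    and ex_cokernel: "f \<in> Ar A \<Longrightarrow> \<exists>c. is_cokernel A c f"
    and monic_normal: "monic A f \<Longrightarrow> \<exists>g. is_kernel A f g"
    and epic_normal: "epic A f \<Longrightarrow> \<exists>g. is_cokernel A f g"

definition short_exact :: "('o, 'm, 'e) precat_scheme \<Rightarrow> 'm \<Rightarrow> 'm \<Rightarrow> bool" where
  "short_exact A f g \<longleftrightarrow> is_kernel A f g \<and> is_cokernel A g f"

definition simple_object :: "('o, 'm, 'e) precat_scheme \<Rightarrow> 'o \<Rightarrow> bool" where
  "simple_object A S \<longleftrightarrow> S \<in> Ob A \<and> \<not> zero_object A S \<and>
    (\<forall>f. monic A f \<and> Cod A f = S \<longrightarrow> zero_object A (Dom A f) \<or> is_iso A f)"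

text \<open>
  A composition series of \<open>X\<close> is a chain of subobjects \<open>0 = Y 0 \<subseteq> Y 1 \<subseteq> \<dots> \<subseteq> Y n = X\<close>, given by its
  successive inclusions \<open>i k\<close>, whose successive quotients (with projections \<open>p k\<close>) are simple.
\<close>

definition composition_series ::
    "('o, 'm, 'e) precat_scheme \<Rightarrow> 'o \<Rightarrow> nat \<Rightarrow> (nat \<Rightarrow> 'o) \<Rightarrow> (nat \<Rightarrow> 'm) \<Rightarrow> (nat \<Rightarrow> 'm) \<Rightarrow> bool" where
  "composition_series A X n Y i p \<longleftrightarrow> zero_object A (Y 0) \<and> Y n = X \<and>
    (\<forall>k<n. i k \<in> Hom A (Y k) (Y (Suc k)) \<and> short_exact A (i k) (p k) \<and>
       simple_object A (Cod A (p k)))"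

locale abelian_length_category = abelian_category +
  assumes ex_composition_series: "X \<in> Ob A \<Longrightarrow> \<exists>n Y i p. composition_series A X n Y i p"

section \<open>Torsion classes and wide subcategories\<close>

text \<open>A full subcategory closed under isomorphism is identified with its set of objects.\<close>

definition subcategory :: "('o, 'm, 'e) precat_scheme \<Rightarrow> 'o set \<Rightarrow> bool" where
  "subcategory A \<X> \<longleftrightarrow> \<X> \<subseteq> Ob A \<and> (\<forall>X\<in>\<X>. \<forall>Y. iso_objs A X Y \<longrightarrow> Y \<in> \<X>)"

definition closed_extensions :: "('o, 'm, 'e) precat_scheme \<Rightarrow> 'o set \<Rightarrow> bool" where
  "closed_extensions A \<X> \<longleftrightarrow>
    (\<forall>f g. short_exact A f g \<and> Dom A f \<in> \<X> \<and> Cod A g \<in> \<X> \<longrightarrow> Cod A f \<in> \<X>)"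

definition closed_factors :: "('o, 'm, 'e) precat_scheme \<Rightarrow> 'o set \<Rightarrow> bool" where
  "closed_factors A \<X> \<longleftrightarrow> (\<forall>f. epic A f \<and> Dom A f \<in> \<X> \<longrightarrow> Cod A f \<in> \<X>)"

definition closed_kernels :: "('o, 'm, 'e) precat_scheme \<Rightarrow> 'o set \<Rightarrow> bool" where
  "closed_kernels A \<X> \<longleftrightarrow>
    (\<forall>k f. is_kernel A k f \<and> Dom A f \<in> \<X> \<and> Cod A f \<in> \<X> \<longrightarrow> Dom A k \<in> \<X>)"

definition closed_cokernels :: "('o, 'm, 'e) precat_scheme \<Rightarrow> 'o set \<Rightarrow> bool" where
  "closed_cokernels A \<X> \<longleftrightarrow>
    (\<forall>c f. is_cokernel A c f \<and> Dom A f \<in> \<X> \<and> Cod A f \<in> \<X> \<longrightarrow> Cod A c \<in> \<X>)"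

text \<open>
  As usual, the empty subcategory is excluded, so that torsion classes and wide subcategories
  contain the zero objects; in particular the smallest torsion class consists of the zero objects.
\<close>

definition torsion_class :: "('o, 'm, 'e) precat_scheme \<Rightarrow> 'o set \<Rightarrow> bool" where
  "torsion_class A \<T> \<longleftrightarrow>
    subcategory A \<T> \<and> \<T> \<noteq> {} \<and> closed_extensions A \<T> \<and> closed_factors A \<T>"

definition tors :: "('o, 'm, 'e) precat_scheme \<Rightarrow> 'o set set" where
  "tors A = {\<T>. torsion_class A \<T>}"

definition wide :: "('o, 'm, 'e) precat_scheme \<Rightarrow> 'o set \<Rightarrow> bool" where
  "wide A \<W> \<longleftrightarrow> subcategory A \<W> \<and> \<W> \<noteq> {} \<and>
    closed_kernels A \<W> \<and> closed_cokernels A \<W> \<and> closed_extensions A \<W>"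

definition tors_gen :: "('o, 'm, 'e) precat_scheme \<Rightarrow> 'o set \<Rightarrow> 'o set" where
  "tors_gen A \<X> = torsion_class A hull \<X>"

definition widely_generated :: "('o, 'm, 'e) precat_scheme \<Rightarrow> 'o set \<Rightarrow> bool" where
  "widely_generated A \<T> \<longleftrightarrow> (\<exists>\<W>. wide A \<W> \<and> \<T> = tors_gen A \<W>)"

definition W_L :: "('o, 'm, 'e) precat_scheme \<Rightarrow> 'o set \<Rightarrow> 'o set" where
  "W_L A \<T> = {X \<in> \<T>. \<forall>Y\<in>\<T>. \<forall>g\<in>Hom A Y X. \<forall>k. is_kernel A k g \<longrightarrow> Dom A k \<in> \<T>}"

definition right_perp :: "('o, 'm, 'e) precat_scheme \<Rightarrow> 'o set \<Rightarrow> 'o set" where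
  "right_perp A \<X> = {Y \<in> Ob A. \<forall>X\<in>\<X>. Hom A X Y = {Null A X Y}}"

section \<open>Hasse arrows and brick labels\<close>

definition hasse_arrow :: "('o, 'm, 'e) precat_scheme \<Rightarrow> 'o set \<Rightarrow> 'o set \<Rightarrow> bool" where
  "hasse_arrow A \<V>\<^sub>1 \<V>\<^sub>2 \<longleftrightarrow> \<V>\<^sub>1 \<in> tors A \<and> \<V>\<^sub>2 \<in> tors A \<and> \<V>\<^sub>2 \<subset> \<V>\<^sub>1 \<and>
    \<not> (\<exists>\<U>\<in>tors A. \<V>\<^sub>2 \<subset> \<U> \<and> \<U> \<subset> \<V>\<^sub>1)"

definition End_ring :: "('o, 'm, 'e) precat_scheme \<Rightarrow> 'o \<Rightarrow> 'm ring" where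
  "End_ring A X =
    \<lparr>carrier = Hom A X X, monoid.mult = Comp A, one = Id A X, zero = Null A X X, add = Plus A\<rparr>"

locale division_ring = ring +
  assumes one_not_zero: "\<one> \<noteq> \<zero>"
    and nonzero_Units: "carrier R - {\<zero>} \<subseteq> Units R"

definition brick :: "('o, 'm, 'e) precat_scheme \<Rightarrow> 'o \<Rightarrow> bool" where
  "brick A X \<longleftrightarrow> X \<in> Ob A \<and> division_ring (End_ring A X)"

text \<open>
  A brick label is an isomorphism class; \<open>is_brick_label A \<V>\<^sub>1 \<V>\<^sub>2 S\<close> says that the label of the Hasse
  arrow \<open>\<V>\<^sub>1 \<rightarrow> \<V>\<^sub>2\<close> is the isomorphism class of \<open>S\<close>. Accordingly, \<open>brick_labels_from A \<T>\<close> is the union of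
  the isomorphism classes that label the arrows starting at \<open>\<T>\<close>.
\<close>

definition is_brick_label ::
    "('o, 'm, 'e) precat_scheme \<Rightarrow> 'o set \<Rightarrow> 'o set \<Rightarrow> 'o \<Rightarrow> bool" where
  "is_brick_label A \<V>\<^sub>1 \<V>\<^sub>2 S \<longleftrightarrow> hasse_arrow A \<V>\<^sub>1 \<V>\<^sub>2 \<and>
    brick A S \<and> S \<in> right_perp A \<V>\<^sub>2 \<inter> \<V>\<^sub>1 \<and>
    (\<forall>S'\<in>right_perp A \<V>\<^sub>2 \<inter> \<V>\<^sub>1. brick A S' \<longrightarrow> iso_objs A S' S)"

definition brick_labels_from :: "('o, 'm, 'e) precat_scheme \<Rightarrow> 'o set \<Rightarrow> 'o set" where
  "brick_labels_from A \<T> = {S. \<exists>\<U>. is_brick_label A \<T> \<U> S}"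

end

(*
  For a wide subcategory W, the objects of T(W) whose morphisms to W have kernel in T(W) and cokernel
  in W form a torsion class, so W is contained in W_L(T(W)); as W_L(T) is itself wide, (a) and (b)
  are equivalent.

  The link to Hasse arrows are the objects S of T onto which every nonzero morphism from T is epic.
  If such an S lies in W_L(T), the objects of T without nonzero morphism to S form a lower cover of T,
  and every torsion class below T not containing S lies below this cover. Conversely, for a Hasse
  arrow T -> U, an object of T outside U of minimal length is of this kind, lies in W_L(T), and is the
  unique brick in T orthogonal to U. So a torsion class missing an object of W_L(T) or a label lies
  below some lower cover of T, while no lower cover contains W_L(T) or the labels.
*)

theory Submission
  imports Defs
begin

section \<open>Abelian categories\<close>

text \<open>The condition on lower covers is the hub: (b) and (c) are each matched with (d) and
  never compared directly. The bridge is that the objects S of the overview, when they lie in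
  W_L(T), are exactly the simple objects of the wide subcategory W_L(T): the image of a morphism
  from T to S lies in T, hence in W_L(T), because composing with a monomorphism does not change
  kernels. Lower covers of T thus correspond to simple objects of W_L(T), up to isomorphism.

  The delicate point is that an arrow T -> U only provides an S of minimal length outside U, and
  nothing in that choice mentions kernels. The covering relation has to supply them. For a nonzero Y
  in T that receives no nonzero morphism from U, the objects of T without nonzero morphism to Y form
  a torsion class that contains U and misses Y. It must equal U, so S has a nonzero morphism to Y.
  This one remark produces both the splitting that puts kernels into T and the isomorphism that
  makes the label unique.\<close>

context category
begin

lemma Hom_Ob:
  assumes "f \<in> Hom A X Y"
  shows "X \<in> Ob A" "Y \<in> Ob A"
  using assms Dom_Ob Cod_Ob by (auto simp: Hom_def)

lemma monic_cancel:
  assumes "monic A f" "f \<in> Hom A X Y" "g \<in> Hom A W X" "h \<in> Hom A W X" "f \<cdot> g = f \<cdot> h"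
  shows "g = h"
  using assms by (auto simp: monic_def Hom_def)

lemma epic_cancel:
  assumes "epic A f" "f \<in> Hom A X Y" "g \<in> Hom A Y Z" "h \<in> Hom A Y Z" "g \<cdot> f = h \<cdot> f"
  shows "g = h"
  using assms by (auto simp: epic_def Hom_def)

lemma monic_Comp:
  assumes "monic A f" "f \<in> Hom A X Y" "monic A g" "g \<in> Hom A Y Z"
  shows "monic A (g \<cdot> f)"
proof -
  have gf: "g \<cdot> f \<in> Hom A X Z"
    using assms Comp_Hom by blast
  have "a = b" if "a \<in> Hom A W X" "b \<in> Hom A W X" "(g \<cdot> f) \<cdot> a = (g \<cdot> f) \<cdot> b" for W a b
  proof -
    have "g \<cdot> (f \<cdot> a) = g \<cdot> (f \<cdot> b)"
      using that assms Comp_assoc[OF _ assms(2,4)] by simp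
    then have "f \<cdot> a = f \<cdot> b"
      using monic_cancel[OF assms(3,4)] Comp_Hom[OF _ assms(2)] that by blast
    then show ?thesis
      using monic_cancel[OF assms(1,2)] that by blast
  qed
  then show ?thesis
    using gf by (auto simp: monic_def Hom_def)
qed

lemma epic_Comp:
  assumes "epic A f" "f \<in> Hom A X Y" "epic A g" "g \<in> Hom A Y Z"
  shows "epic A (g \<cdot> f)"
proof -
  have gf: "g \<cdot> f \<in> Hom A X Z"
    using assms Comp_Hom by blast
  have "a = b" if "a \<in> Hom A Z W" "b \<in> Hom A Z W" "a \<cdot> (g \<cdot> f) = b \<cdot> (g \<cdot> f)" for W a b
  proof -
    have "(a \<cdot> g) \<cdot> f = (b \<cdot> g) \<cdot> f"
      using that assms Comp_assoc[OF assms(2,4)] by simp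
    then have "a \<cdot> g = b \<cdot> g"
      using epic_cancel[OF assms(1,2)] Comp_Hom[OF assms(4)] that by blast
    then show ?thesis
      using epic_cancel[OF assms(3,4)] that by blast
  qed
  then show ?thesis
    using gf by (auto simp: epic_def Hom_def)
qed

lemma monic_Comp_right:
  assumes "monic A (g \<cdot> f)" "f \<in> Hom A X Y" "g \<in> Hom A Y Z"
  shows "monic A f"
proof -
  have gf: "g \<cdot> f \<in> Hom A X Z"
    using assms Comp_Hom by blast
  have "a = b" if "a \<in> Hom A W X" "b \<in> Hom A W X" "f \<cdot> a = f \<cdot> b" for W a b
    using that(3) monic_cancel[OF assms(1) gf that(1,2)]
      Comp_assoc[OF that(1) assms(2,3)] Comp_assoc[OF that(2) assms(2,3)] by simp
  then show ?thesis
    using assms by (auto simp: monic_def Hom_def)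
qed

lemma epic_Comp_left:
  assumes "epic A (g \<cdot> f)" "f \<in> Hom A X Y" "g \<in> Hom A Y Z"
  shows "epic A g"
proof -
  have gf: "g \<cdot> f \<in> Hom A X Z"
    using assms Comp_Hom by blast
  have "a = b" if "a \<in> Hom A Z W" "b \<in> Hom A Z W" "a \<cdot> g = b \<cdot> g" for W a b
    using that(3) epic_cancel[OF assms(1) gf that(1,2)]
      Comp_assoc[OF assms(2,3) that(1)] Comp_assoc[OF assms(2,3) that(2)] by simp
  then show ?thesis
    using assms by (auto simp: epic_def Hom_def)
qed

lemma monic_Id: "X \<in> Ob A \<Longrightarrow> monic A (Id A X)"
  using Id_Hom[of X] Id_Comp by (simp add: monic_def Hom_def) metis

lemma epic_Id: "X \<in> Ob A \<Longrightarrow> epic A (Id A X)"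
  using Id_Hom[of X] Comp_Id by (simp add: epic_def Hom_def) metis

lemma isoI:
  assumes "f \<in> Hom A X Y" "g \<in> Hom A Y X" "g \<cdot> f = Id A X" "f \<cdot> g = Id A Y"
  shows "is_iso A f"
  using assms by (auto simp: is_iso_def Hom_def)

lemma isoE:
  assumes "is_iso A f" "f \<in> Hom A X Y"
  obtains g where "g \<in> Hom A Y X" "g \<cdot> f = Id A X" "f \<cdot> g = Id A Y"
  using assms by (auto simp: is_iso_def Hom_def)

lemma iso_monic: "is_iso A f \<Longrightarrow> f \<in> Hom A X Y \<Longrightarrow> monic A f"
  using isoE[of f X Y] monic_Comp_right[of _ f X Y X] monic_Id[of X] Hom_Ob[of f X Y] by metis

lemma iso_epic: "is_iso A f \<Longrightarrow> f \<in> Hom A X Y \<Longrightarrow> epic A f"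
  using isoE[of f X Y] epic_Comp_left[of f _ Y X Y] epic_Id[of Y] Hom_Ob[of f X Y] by metis

lemma iso_objs_sym: "iso_objs A X Y \<Longrightarrow> iso_objs A Y X"
  unfolding iso_objs_def by (metis isoE isoI)

lemma iso_objs_epic:
  assumes "iso_objs A X Y"
  obtains f where "f \<in> Hom A X Y" "epic A f"
  using assms unfolding iso_objs_def by (metis iso_epic)

end

section \<open>Zero morphisms, kernels and cokernels in a preadditive category\<close>

context preadditive_category
begin

lemma Null_Hom: "X \<in> Ob A \<Longrightarrow> Y \<in> Ob A \<Longrightarrow> Null A X Y \<in> Hom A X Y"
  using monoid.one_closed[of "Hom_group A X Y"] Hom_comm_group[of X Y]
  by (simp add: Hom_group_def comm_group_def group_def)

lemma Null_Hom_of: "f \<in> Hom A X Y \<Longrightarrow> Null A X Y \<in> Hom A X Y"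
  using Null_Hom Hom_Ob by blast

lemma Plus_Hom:
  assumes "f \<in> Hom A X Y" "g \<in> Hom A X Y"
  shows "Plus A f g \<in> Hom A X Y"
proof -
  interpret comm_group "Hom_group A X Y"
    using Hom_comm_group Hom_Ob assms by blast
  show ?thesis
    using m_closed[of f g] assms by (simp add: Hom_group_def)
qed

lemma Null_Plus:
  assumes "f \<in> Hom A X Y"
  shows "Plus A (Null A X Y) f = f"
proof -
  interpret comm_group "Hom_group A X Y"
    using Hom_comm_group Hom_Ob assms by blast
  show ?thesis
    using l_one[of f] assms by (simp add: Hom_group_def)
qed

lemma Plus_Null:
  assumes "f \<in> Hom A X Y"
  shows "Plus A f (Null A X Y) = f"
proof -
  interpret comm_group "Hom_group A X Y"
    using Hom_comm_group Hom_Ob assms by blast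
  show ?thesis
    using r_one[of f] assms by (simp add: Hom_group_def)
qed

lemma ex_diff:
  assumes "f \<in> Hom A X Y" "g \<in> Hom A X Y"
  obtains d where "d \<in> Hom A X Y" "f = Plus A d g"
proof -
  interpret comm_group "Hom_group A X Y"
    using Hom_comm_group Hom_Ob assms by blast
  let ?d = "f \<otimes>\<^bsub>Hom_group A X Y\<^esub> inv\<^bsub>Hom_group A X Y\<^esub> g"
  have fg: "f \<in> carrier (Hom_group A X Y)" "g \<in> carrier (Hom_group A X Y)"
    using assms by (auto simp: Hom_group_def)
  then have "?d \<in> carrier (Hom_group A X Y)" "f = ?d \<otimes>\<^bsub>Hom_group A X Y\<^esub> g"
    by (auto simp: m_assoc)
  then show ?thesis
    using that by (simp add: Hom_group_def)
qed

lemma Plus_eq_right: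
  assumes "d \<in> Hom A X Y" "f \<in> Hom A X Y" "Plus A d f = f"
  shows "d = Null A X Y"
proof -
  interpret comm_group "Hom_group A X Y"
    using Hom_comm_group Hom_Ob assms by blast
  show ?thesis
    using r_cancel_one[of f d] assms by (simp add: Hom_group_def)
qed

lemma Plus_eq_left:
  assumes "d \<in> Hom A X Y" "f \<in> Hom A X Y" "Plus A f d = f"
  shows "d = Null A X Y"
proof -
  interpret comm_group "Hom_group A X Y"
    using Hom_comm_group Hom_Ob assms by blast
  show ?thesis
    using l_cancel_one[of f d] assms by (simp add: Hom_group_def)
qed

lemma Comp_Null:
  assumes "g \<in> Hom A Y Z" "X \<in> Ob A"
  shows "g \<cdot> Null A X Y = Null A X Z"
proof -
  have n: "Null A X Y \<in> Hom A X Y"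
    using assms Hom_Ob Null_Hom by blast
  have "Plus A (g \<cdot> Null A X Y) (g \<cdot> Null A X Y) = g \<cdot> Null A X Y"
    using Comp_Plus[OF n n assms(1)] Plus_Null[OF n] by simp
  then show ?thesis
    using Plus_eq_right Comp_Hom n assms by blast
qed

lemma Null_Comp:
  assumes "f \<in> Hom A X Y" "Z \<in> Ob A"
  shows "Null A Y Z \<cdot> f = Null A X Z"
proof -
  have n: "Null A Y Z \<in> Hom A Y Z"
    using assms Hom_Ob Null_Hom by blast
  have "Plus A (Null A Y Z \<cdot> f) (Null A Y Z \<cdot> f) = Null A Y Z \<cdot> f"
    using Plus_Comp[OF assms(1) n n] Plus_Null[OF n] by simp
  then show ?thesis
    using Plus_eq_right Comp_Hom n assms by blast
qed

text \<open>Parallel morphisms have a difference (\<open>ex_diff\<close>), so cancellation only has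
  to be tested against zero.\<close>

lemma monicI:
  assumes f: "f \<in> Hom A X Y"
    and "\<And>W h. h \<in> Hom A W X \<Longrightarrow> f \<cdot> h = Null A W Y \<Longrightarrow> h = Null A W X"
  shows "monic A f"
proof -
  have "g = h" if g: "g \<in> Hom A W X" and h: "h \<in> Hom A W X" and eq: "f \<cdot> g = f \<cdot> h" for W g h
  proof -
    obtain d where d: "d \<in> Hom A W X" "g = Plus A d h"
      using ex_diff g h by blast
    have "f \<cdot> h = Plus A (f \<cdot> d) (f \<cdot> h)"
      using Comp_Plus[OF d(1) h f] eq d(2) by simp
    then have "f \<cdot> d = Null A W Y"
      using Plus_eq_right[of "f \<cdot> d" W Y "f \<cdot> h"] Comp_Hom[OF _ f] d h by simp
    then show ?thesis
      using assms(2)[OF d(1)] d(2) Null_Plus[OF h] by simp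
  qed
  then show ?thesis
    using f by (auto simp: monic_def Hom_def)
qed

lemma epicI:
  assumes f: "f \<in> Hom A X Y"
    and "\<And>Z h. h \<in> Hom A Y Z \<Longrightarrow> h \<cdot> f = Null A X Z \<Longrightarrow> h = Null A Y Z"
  shows "epic A f"
proof -
  have "g = h" if g: "g \<in> Hom A Y Z" and h: "h \<in> Hom A Y Z" and eq: "g \<cdot> f = h \<cdot> f" for Z g h
  proof -
    obtain d where d: "d \<in> Hom A Y Z" "g = Plus A d h"
      using ex_diff g h by blast
    have "h \<cdot> f = Plus A (d \<cdot> f) (h \<cdot> f)"
      using Plus_Comp[OF f d(1) h] eq d(2) by simp
    then have "d \<cdot> f = Null A X Z"
      using Plus_eq_right[of "d \<cdot> f" X Z "h \<cdot> f"] Comp_Hom[OF f] d h by simp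
    then show ?thesis
      using assms(2)[OF d(1)] d(2) Null_Plus[OF h] by simp
  qed
  then show ?thesis
    using f by (auto simp: epic_def Hom_def)
qed

lemma monic_Null:
  assumes "monic A f" "f \<in> Hom A X Y" "h \<in> Hom A W X" "f \<cdot> h = Null A W Y"
  shows "h = Null A W X"
proof -
  have "f \<cdot> Null A W X = Null A W Y"
    using Comp_Null assms(2,3) Hom_Ob by blast
  then show ?thesis
    using monic_cancel[OF assms(1-3) Null_Hom_of[OF assms(3)]] assms(4) by simp
qed

lemma epic_Null:
  assumes "epic A f" "f \<in> Hom A X Y" "h \<in> Hom A Y Z" "h \<cdot> f = Null A X Z"
  shows "h = Null A Y Z"
proof -
  have "Null A Y Z \<cdot> f = Null A X Z"
    using Null_Comp assms(2,3) Hom_Ob by blast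
  then show ?thesis
    using epic_cancel[OF assms(1-3) Null_Hom_of[OF assms(3)]] assms(4) by simp
qed

lemma kernel_Hom:
  assumes "is_kernel A k f" "f \<in> Hom A X Y"
  shows "k \<in> Hom A (Dom A k) X"
  using assms by (auto simp: is_kernel_def Hom_def)

lemma kernel_Null:
  assumes "is_kernel A k f" "f \<in> Hom A X Y"
  shows "f \<cdot> k = Null A (Dom A k) Y"
  using assms by (auto simp: is_kernel_def Hom_def)

lemma kernel_factor:
  assumes "is_kernel A k f" "f \<in> Hom A X Y" "h \<in> Hom A W X" "f \<cdot> h = Null A W Y"
  obtains u where "u \<in> Hom A W (Dom A k)" "k \<cdot> u = h"
proof -
  have "Dom A f = X" "Cod A f = Y"
    using assms by (auto simp: Hom_def)
  with assms show ?thesis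
    using that unfolding is_kernel_def by metis
qed

lemma kernel_monic:
  assumes "is_kernel A k f"
  shows "monic A k"
proof -
  have *: "f \<in> Hom A (Dom A f) (Cod A f)" "k \<in> Hom A (Dom A k) (Dom A f)"
    using assms by (auto simp: is_kernel_def Hom_def)
  have "h = Null A W (Dom A k)" if h: "h \<in> Hom A W (Dom A k)" "k \<cdot> h = Null A W (Dom A f)" for W h
  proof -
    have W: "W \<in> Ob A" and n: "Null A W (Dom A f) \<in> Hom A W (Dom A f)"
      and n': "Null A W (Dom A k) \<in> Hom A W (Dom A k)"
      using h * by (auto intro: Hom_Ob Null_Hom)
    have "f \<cdot> Null A W (Dom A f) = Null A W (Cod A f)" "k \<cdot> Null A W (Dom A k) = Null A W (Dom A f)"
      using * W Comp_Null by blast+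
    then show ?thesis
      using assms n n' h unfolding is_kernel_def by metis
  qed
  then show ?thesis
    using * monicI by blast
qed

lemma kernelI:
  assumes "k \<in> Hom A K X" "f \<in> Hom A X Y" "monic A k" "f \<cdot> k = Null A K Y"
    and "\<And>W h. h \<in> Hom A W X \<Longrightarrow> f \<cdot> h = Null A W Y \<Longrightarrow> \<exists>u\<in>Hom A W K. k \<cdot> u = h"
  shows "is_kernel A k f"
proof -
  have eqs: "k \<in> Ar A" "Dom A k = K" "Cod A k = X" "f \<in> Ar A" "Dom A f = X" "Cod A f = Y"
    using assms by (auto simp: Hom_def)
  have "\<exists>!u. u \<in> Hom A W K \<and> k \<cdot> u = h" if "h \<in> Hom A W X" "f \<cdot> h = Null A W Y" for W h
    using assms(5)[OF that] monic_cancel[OF assms(3,1)] by metis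
  then show ?thesis
    using assms(4) by (simp add: is_kernel_def eqs)
qed

lemma cokernel_Hom:
  assumes "is_cokernel A c f" "f \<in> Hom A X Y"
  shows "c \<in> Hom A Y (Cod A c)"
  using assms by (auto simp: is_cokernel_def Hom_def)

lemma cokernel_Null:
  assumes "is_cokernel A c f" "f \<in> Hom A X Y"
  shows "c \<cdot> f = Null A X (Cod A c)"
  using assms by (auto simp: is_cokernel_def Hom_def)

lemma cokernel_factor:
  assumes "is_cokernel A c f" "f \<in> Hom A X Y" "h \<in> Hom A Y Z" "h \<cdot> f = Null A X Z"
  obtains u where "u \<in> Hom A (Cod A c) Z" "u \<cdot> c = h"
proof -
  have "Dom A f = X" "Cod A f = Y"
    using assms by (auto simp: Hom_def)
  with assms show ?thesis
    using that unfolding is_cokernel_def by metis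
qed

lemma cokernel_epic:
  assumes "is_cokernel A c f"
  shows "epic A c"
proof -
  have *: "f \<in> Hom A (Dom A f) (Cod A f)" "c \<in> Hom A (Cod A f) (Cod A c)"
    using assms by (auto simp: is_cokernel_def Hom_def)
  have "h = Null A (Cod A c) W" if h: "h \<in> Hom A (Cod A c) W" "h \<cdot> c = Null A (Cod A f) W" for W h
  proof -
    have W: "W \<in> Ob A" and n: "Null A (Cod A f) W \<in> Hom A (Cod A f) W"
      and n': "Null A (Cod A c) W \<in> Hom A (Cod A c) W"
      using h * by (auto intro: Hom_Ob Null_Hom)
    have "Null A (Cod A f) W \<cdot> f = Null A (Dom A f) W" "Null A (Cod A c) W \<cdot> c = Null A (Cod A f) W"
      using * W Null_Comp by blast+
    then show ?thesis
      using assms n n' h unfolding is_cokernel_def by metis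
  qed
  then show ?thesis
    using * epicI by blast
qed

lemma cokernelI:
  assumes "c \<in> Hom A Y C" "f \<in> Hom A X Y" "epic A c" "c \<cdot> f = Null A X C"
    and "\<And>Z h. h \<in> Hom A Y Z \<Longrightarrow> h \<cdot> f = Null A X Z \<Longrightarrow> \<exists>u\<in>Hom A C Z. u \<cdot> c = h"
  shows "is_cokernel A c f"
proof -
  have eqs: "c \<in> Ar A" "Dom A c = Y" "Cod A c = C" "f \<in> Ar A" "Dom A f = X" "Cod A f = Y"
    using assms by (auto simp: Hom_def)
  have "\<exists>!u. u \<in> Hom A C Z \<and> u \<cdot> c = h" if "h \<in> Hom A Y Z" "h \<cdot> f = Null A X Z" for Z h
    using assms(5)[OF that] epic_cancel[OF assms(3,1)] by metis
  then show ?thesis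
    using assms(4) by (simp add: is_cokernel_def eqs)
qed

text \<open>Every morphism into or out of X is a composite with \<open>Id A X\<close>, so it
  vanishes once the identity does.\<close>

lemma zero_object_iff: "zero_object A X \<longleftrightarrow> X \<in> Ob A \<and> Id A X = Null A X X"
proof
  assume "zero_object A X"
  then show "X \<in> Ob A \<and> Id A X = Null A X X"
    unfolding zero_object_def using Id_Hom Null_Hom by metis
next
  assume X: "X \<in> Ob A \<and> Id A X = Null A X X"
  have "f = Null A Y X" if "f \<in> Hom A Y X" for f Y
    using that X Id_Comp[of f Y X] Null_Comp[of f Y X X] by simp
  moreover have "f = Null A X Y" if "f \<in> Hom A X Y" for f Y
    using that X Comp_Id Comp_Null by metis
  ultimately show "zero_object A X"
    unfolding zero_object_def using X Null_Hom by metis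
qed

lemma Hom_zero_left:
  assumes "zero_object A X" "f \<in> Hom A X Y"
  shows "f = Null A X Y"
  using assms Comp_Id[OF assms(2)] Comp_Null[OF assms(2), of X] by (simp add: zero_object_iff)

lemma Hom_zero_right:
  assumes "zero_object A Y" "f \<in> Hom A X Y"
  shows "f = Null A X Y"
  using assms Id_Comp[OF assms(2)] Null_Comp[OF assms(2), of Y] by (simp add: zero_object_iff)

lemma epic_to_zero: "zero_object A Z \<Longrightarrow> f \<in> Hom A X Z \<Longrightarrow> epic A f"
  by (meson Hom_zero_left epicI)

lemma monic_zero_imp:
  assumes "monic A f" "f \<in> Hom A X Y" "f = Null A X Y"
  shows "zero_object A X"
  using assms monic_Null[OF assms(1,2) Id_Hom] Comp_Id[OF assms(2)] Hom_Ob[OF assms(2)]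
  by (simp add: zero_object_iff)

lemma epic_zero_imp:
  assumes "epic A f" "f \<in> Hom A X Y" "f = Null A X Y"
  shows "zero_object A Y"
  using assms epic_Null[OF assms(1,2) Id_Hom] Id_Comp[OF assms(2)] Hom_Ob[OF assms(2)]
  by (simp add: zero_object_iff)

end

section \<open>Images, pullbacks and generalized elements in an abelian category\<close>

context abelian_category
begin

lemma obtain_zero_object:
  obtains Z where "zero_object A Z" "Z \<in> Ob A"
  using ex_zero_object by (auto simp: zero_object_def)

lemma obtain_kernel:
  assumes "f \<in> Hom A X Y"
  obtains K k where "k \<in> Hom A K X" "is_kernel A k f" "monic A k" "f \<cdot> k = Null A K Y"
  using assms ex_kernel[of f] kernel_Hom kernel_monic kernel_Null by (auto simp: Hom_def)

lemma obtain_cokernel: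
  assumes "f \<in> Hom A X Y"
  obtains C c where "c \<in> Hom A Y C" "is_cokernel A c f" "epic A c" "c \<cdot> f = Null A X C"
  using assms ex_cokernel[of f] cokernel_Hom cokernel_epic cokernel_Null by (auto simp: Hom_def)

lemma obtain_monic_normal:
  assumes "monic A m" "m \<in> Hom A X Y"
  obtains Z g where "g \<in> Hom A Y Z" "is_kernel A m g"
  using assms monic_normal[of m] by (auto simp: is_kernel_def Hom_def)

lemma obtain_epic_normal:
  assumes "epic A e" "e \<in> Hom A X Y"
  obtains Z g where "g \<in> Hom A Z X" "is_cokernel A e g"
  using assms epic_normal[of e] by (auto simp: is_cokernel_def Hom_def)

text \<open>The epimorphism g is the cokernel of some t. As g kills t, t factors through k, so
  whatever kills k kills t and hence factors through g.\<close>

lemma kernel_of_epic_short_exact: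
  assumes g: "g \<in> Hom A X Y" "epic A g" and k: "is_kernel A k g"
  shows "short_exact A k g"
proof -
  have kH: "k \<in> Hom A (Dom A k) X"
    using kernel_Hom[OF k g(1)] .
  obtain Z t where t: "t \<in> Hom A Z X" "is_cokernel A g t"
    using obtain_epic_normal g by blast
  have "g \<cdot> t = Null A Z Y"
    using cokernel_Null[OF t(2,1)] g(1) by (simp add: Hom_def)
  then obtain u where u: "u \<in> Hom A Z (Dom A k)" "k \<cdot> u = t"
    using kernel_factor[OF k g(1) t(1)] by blast
  have "\<exists>v\<in>Hom A Y W. v \<cdot> g = h" if h: "h \<in> Hom A X W" "h \<cdot> k = Null A (Dom A k) W" for W h
  proof -
    have "h \<cdot> t = Null A Z W"
      using Comp_assoc[OF u(1) kH h(1)] u(2) h(2) Null_Comp[OF u(1)] Hom_Ob[OF h(1)] by simp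
    then show ?thesis
      using cokernel_factor[OF t(2,1) h(1)] g(1) by (auto simp: Hom_def)
  qed
  then have "is_cokernel A g k"
    using cokernelI[OF g(1) kH g(2) kernel_Null[OF k g(1)]] by blast
  then show ?thesis
    using k by (simp add: short_exact_def)
qed

text \<open>Dually, f is the kernel of some t, which factors through c, so whatever c kills is
  killed by t and lifts along f.\<close>

lemma cokernel_of_monic_short_exact:
  assumes f: "f \<in> Hom A X Y" "monic A f" and c: "is_cokernel A c f"
  shows "short_exact A f c"
proof -
  have cH: "c \<in> Hom A Y (Cod A c)"
    using cokernel_Hom[OF c f(1)] .
  obtain Z t where t: "t \<in> Hom A Y Z" "is_kernel A f t"
    using obtain_monic_normal f by blast
  have "t \<cdot> f = Null A X Z"
    using kernel_Null[OF t(2,1)] f(1) by (simp add: Hom_def)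
  then obtain u where u: "u \<in> Hom A (Cod A c) Z" "u \<cdot> c = t"
    using cokernel_factor[OF c f(1) t(1)] by blast
  have "\<exists>v\<in>Hom A W X. f \<cdot> v = h" if h: "h \<in> Hom A W Y" "c \<cdot> h = Null A W (Cod A c)" for W h
  proof -
    have "t \<cdot> h = Null A W Z"
      using Comp_assoc[OF h(1) cH u(1)] u(2) h(2) Comp_Null[OF u(1)] Hom_Ob[OF h(1)] by simp
    then show ?thesis
      using kernel_factor[OF t(2,1) h(1)] f(1) by (auto simp: Hom_def)
  qed
  then have "is_kernel A f c"
    using kernelI[OF f(1) cH f(2) cokernel_Null[OF c f(1)]] by blast
  then show ?thesis
    using c by (simp add: short_exact_def)
qed

text \<open>A monic f is the kernel of some g, and f epic forces g = 0. The identity then factors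
  through f, giving a right inverse that monicity turns into a two-sided one.\<close>

lemma monic_epic_iso:
  assumes f: "f \<in> Hom A X Y" "monic A f" "epic A f"
  shows "is_iso A f"
proof -
  obtain Z g where g: "g \<in> Hom A Y Z" "is_kernel A f g"
    using obtain_monic_normal f by blast
  have Y: "Id A Y \<in> Hom A Y Y" and X: "Id A X \<in> Hom A X X"
    using Hom_Ob[OF f(1)] Id_Hom by auto
  have "g \<cdot> f = Null A X Z"
    using kernel_Null[OF g(2,1)] f(1) by (simp add: Hom_def)
  then have "g = Null A Y Z"
    using epic_Null[OF f(3,1) g(1)] by simp
  then have "g \<cdot> Id A Y = Null A Y Z"
    using Comp_Id[OF g(1)] by simp
  then obtain v where v: "v \<in> Hom A Y X" "f \<cdot> v = Id A Y"
    using kernel_factor[OF g(2,1) Y] f(1) by (auto simp: Hom_def)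
  have "f \<cdot> (v \<cdot> f) = f \<cdot> Id A X"
    using Comp_assoc[OF f(1) v(1) f(1)] v(2) Id_Comp[OF f(1)] Comp_Id[OF f(1)] by simp
  then have "v \<cdot> f = Id A X"
    using monic_cancel[OF f(2,1) Comp_Hom[OF f(1) v(1)] X] by simp
  then show ?thesis
    using isoI f(1) v by blast
qed

text \<open>Descent along covers: m is the kernel of some t, and t h w = 0 forces t h = 0 because w
  is epic. This turns a lift found on a cover into a lift of h itself.\<close>

lemma monic_factor_epic:
  assumes m: "m \<in> Hom A X Y" "monic A m" and h: "h \<in> Hom A W Y"
    and w: "w \<in> Hom A V W" "epic A w" and u: "u \<in> Hom A V X" "h \<cdot> w = m \<cdot> u"
  obtains v where "v \<in> Hom A W X" "m \<cdot> v = h"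
proof -
  obtain Z t where t: "t \<in> Hom A Y Z" "is_kernel A m t"
    using obtain_monic_normal m by blast
  have tm: "t \<cdot> m = Null A X Z"
    using kernel_Null[OF t(2,1)] m(1) by (simp add: Hom_def)
  have "(t \<cdot> h) \<cdot> w = Null A V Z"
    using Comp_assoc[OF w(1) h t(1)] u(2) Comp_assoc[OF u(1) m(1) t(1)] tm
      Null_Comp[OF u(1)] Hom_Ob[OF t(1)] by simp
  then have "t \<cdot> h = Null A W Z"
    using epic_Null[OF w(2,1) Comp_Hom[OF h t(1)]] by simp
  then show ?thesis
    using kernel_factor[OF t(2,1) h] m(1) that by (auto simp: Hom_def)
qed

text \<open>The image is the kernel of the cokernel of f; the work lies in showing that e is epic.
  If h kills e, then e factors through the kernel n of h, and it suffices that n is split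
  epic.\<close>

lemma image_factorization:
  assumes f: "f \<in> Hom A X Y"
  obtains I e m where "e \<in> Hom A X I" "epic A e" "m \<in> Hom A I Y" "monic A m" "f = m \<cdot> e"
proof -
  obtain C c where c: "c \<in> Hom A Y C" "is_cokernel A c f" "epic A c" "c \<cdot> f = Null A X C"
    using obtain_cokernel f by blast
  obtain I m where m: "m \<in> Hom A I Y" "is_kernel A m c" "monic A m" "c \<cdot> m = Null A I C"
    using obtain_kernel c(1) by blast
  obtain e where e: "e \<in> Hom A X I" "m \<cdot> e = f"
    using kernel_factor[OF m(2) c(1) f c(4)] m(1) by (auto simp: Hom_def)
  have I: "Id A I \<in> Hom A I I"
    using Id_Hom Hom_Ob[OF m(1)] by simp
  have "h = Null A I V" if h: "h \<in> Hom A I V" "h \<cdot> e = Null A X V" for V h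
  proof -
    obtain N n where n: "n \<in> Hom A N I" "is_kernel A n h" "monic A n" "h \<cdot> n = Null A N V"
      using obtain_kernel h(1) by blast
    obtain e' where e': "e' \<in> Hom A X N" "n \<cdot> e' = e"
      using kernel_factor[OF n(2) h(1) e(1) h(2)] n(1) by (auto simp: Hom_def)
    have mn: "m \<cdot> n \<in> Hom A N Y" "monic A (m \<cdot> n)"
      using Comp_Hom[OF n(1) m(1)] monic_Comp[OF n(3,1) m(3,1)] by auto
    obtain Z t where t: "t \<in> Hom A Y Z" "is_kernel A (m \<cdot> n) t"
      using obtain_monic_normal mn by blast
    have tmn: "t \<cdot> (m \<cdot> n) = Null A N Z"
      using kernel_Null[OF t(2,1)] mn(1) by (simp add: Hom_def)
    have "f = (m \<cdot> n) \<cdot> e'"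
      using e(2) e'(2) Comp_assoc[OF e'(1) n(1) m(1)] by simp
    then have "t \<cdot> f = Null A X Z"
      using Comp_assoc[OF e'(1) mn(1) t(1)] tmn Null_Comp[OF e'(1)] Hom_Ob[OF t(1)] by simp
    then obtain s where s: "s \<in> Hom A C Z" "s \<cdot> c = t"
      using cokernel_factor[OF c(2) f t(1)] c(1) by (auto simp: Hom_def)
    have "t \<cdot> m = Null A I Z"
      using Comp_assoc[OF m(1) c(1) s(1)] s(2) m(4) Comp_Null[OF s(1)] Hom_Ob[OF m(1)] by simp
    then obtain v where v: "v \<in> Hom A I N" "(m \<cdot> n) \<cdot> v = m"
      using kernel_factor[OF t(2,1) m(1)] mn(1) by (auto simp: Hom_def)
    have "m \<cdot> (n \<cdot> v) = m \<cdot> Id A I"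
      using Comp_assoc[OF v(1) n(1) m(1)] v(2) Comp_Id[OF m(1)] by simp
    then have "n \<cdot> v = Id A I"
      using monic_cancel[OF m(3,1) Comp_Hom[OF v(1) n(1)] I] by simp
    then have "h = (h \<cdot> n) \<cdot> v"
      using Comp_assoc[OF v(1) n(1) h(1)] Comp_Id[OF h(1)] by simp
    then show ?thesis
      using n(4) Null_Comp[OF v(1)] Hom_Ob[OF h(1)] by simp
  qed
  then have "epic A e"
    using epicI[OF e(1)] by blast
  then show ?thesis
    using that e m by blast
qed

text \<open>The pullback is the kernel of f p - g q on the biproduct; the difference appears as the
  solution r of f p = r + g q. The last clause, that pullbacks preserve epimorphisms, is what makes
  chases with covers possible.\<close>

lemma pullback:
  assumes f: "f \<in> Hom A X Z" and g: "g \<in> Hom A Y Z"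
  obtains P a b where "a \<in> Hom A P X" "b \<in> Hom A P Y" "f \<cdot> a = g \<cdot> b"
    "\<And>W x y. x \<in> Hom A W X \<Longrightarrow> y \<in> Hom A W Y \<Longrightarrow> f \<cdot> x = g \<cdot> y \<Longrightarrow>
      \<exists>!u. u \<in> Hom A W P \<and> a \<cdot> u = x \<and> b \<cdot> u = y"
    "epic A f \<Longrightarrow> epic A b"
proof -
  have X: "X \<in> Ob A" and Y: "Y \<in> Ob A" and Z: "Z \<in> Ob A"
    using f g Hom_Ob by auto
  obtain S i j p q where "is_biproduct A X Y S i j p q"
    using ex_biproduct X Y by blast
  then have i: "i \<in> Hom A X S" and j: "j \<in> Hom A Y S" and p: "p \<in> Hom A S X" and q: "q \<in> Hom A S Y"
    and pi: "p \<cdot> i = Id A X" and qj: "q \<cdot> j = Id A Y"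
    and sum: "Plus A (i \<cdot> p) (j \<cdot> q) = Id A S"
    by (auto simp: is_biproduct_def)
  have ip: "i \<cdot> p \<in> Hom A S S" and jq: "j \<cdot> q \<in> Hom A S S"
    using Comp_Hom[OF p i] Comp_Hom[OF q j] by auto
  have fp: "f \<cdot> p \<in> Hom A S Z" and gq: "g \<cdot> q \<in> Hom A S Z"
    using Comp_Hom[OF p f] Comp_Hom[OF q g] by auto
  obtain r where r: "r \<in> Hom A S Z" "f \<cdot> p = Plus A r (g \<cdot> q)"
    using ex_diff fp gq by blast
  have split: "Plus A (i \<cdot> (p \<cdot> u)) (j \<cdot> (q \<cdot> u)) = u" if u: "u \<in> Hom A W S" for W u
    using Plus_Comp[OF u ip jq, symmetric] sum Id_Comp[OF u] Comp_assoc[OF u p i] Comp_assoc[OF u q j]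
    by simp
  \<comment> \<open>The biproduct equation composed with i reads i + j q i = i, so j q i = 0, and q
    is a left inverse of j. The other mixed composite \<open>p \<cdot> j\<close> is treated
    alike.\<close>
  have qi: "q \<cdot> i = Null A X Y"
  proof -
    have jqi: "j \<cdot> (q \<cdot> i) \<in> Hom A X S"
      using Comp_Hom i j q by blast
    have "Plus A i (j \<cdot> (q \<cdot> i)) = i"
      using split[OF i] pi Comp_Id[OF i] by simp
    then have "j \<cdot> (q \<cdot> i) = Null A X S"
      using Plus_eq_left[OF jqi i] by simp
    moreover have "q \<cdot> (j \<cdot> (q \<cdot> i)) = q \<cdot> i"
      using Comp_assoc[OF Comp_Hom[OF i q] j q] qj Id_Comp[OF Comp_Hom[OF i q]] by simp
    ultimately show ?thesis
      using Comp_Null[OF q X] by simp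
  qed
  obtain P k where k: "k \<in> Hom A P S" "is_kernel A k r" "monic A k" "r \<cdot> k = Null A P Z"
    using obtain_kernel r(1) by blast
  have eq_iff: "r \<cdot> u = Null A W Z \<longleftrightarrow> f \<cdot> (p \<cdot> u) = g \<cdot> (q \<cdot> u)" if u: "u \<in> Hom A W S" for W u
  proof -
    have "f \<cdot> (p \<cdot> u) = Plus A r (g \<cdot> q) \<cdot> u"
      using Comp_assoc[OF u p f, symmetric] unfolding r(2) .
    then have *: "f \<cdot> (p \<cdot> u) = Plus A (r \<cdot> u) (g \<cdot> (q \<cdot> u))"
      unfolding Plus_Comp[OF u r(1) gq] Comp_assoc[OF u q g] .
    have gqu: "g \<cdot> (q \<cdot> u) \<in> Hom A W Z"
      using Comp_Hom u q g by blast
    show ?thesis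
      unfolding * using Null_Plus[OF gqu] Plus_eq_right[OF Comp_Hom[OF u r(1)] gqu] by auto
  qed
  define a b where "a = p \<cdot> k" and "b = q \<cdot> k"
  have a: "a \<in> Hom A P X" and b: "b \<in> Hom A P Y"
    using Comp_Hom k(1) p q by (auto simp: a_def b_def)
  show ?thesis
  proof
    show "a \<in> Hom A P X" "b \<in> Hom A P Y"
      by fact+
    show "f \<cdot> a = g \<cdot> b"
      using eq_iff[OF k(1)] k(4) by (simp add: a_def b_def)
  next
    fix W x y
    assume x: "x \<in> Hom A W X" and y: "y \<in> Hom A W Y" and xy: "f \<cdot> x = g \<cdot> y"
    define s where "s = Plus A (i \<cdot> x) (j \<cdot> y)"
    have ix: "i \<cdot> x \<in> Hom A W S" and jy: "j \<cdot> y \<in> Hom A W S"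
      using Comp_Hom i j x y by auto
    have s: "s \<in> Hom A W S"
      using Plus_Hom ix jy by (simp add: s_def)
    have pj: "p \<cdot> j = Null A Y X"
    proof -
      have "Plus A (i \<cdot> (p \<cdot> j)) j = j"
        using split[OF j] qj Comp_Id[OF j] by simp
      then have "i \<cdot> (p \<cdot> j) = Null A Y S"
        using Plus_eq_right[OF Comp_Hom[OF Comp_Hom[OF j p] i] j] by simp
      moreover have "p \<cdot> (i \<cdot> (p \<cdot> j)) = p \<cdot> j"
        using Comp_assoc[OF Comp_Hom[OF j p] i p] pi Id_Comp[OF Comp_Hom[OF j p]] by simp
      ultimately show ?thesis
        using Comp_Null[OF p Y] by simp
    qed
    have ps: "p \<cdot> s = x"
      using Comp_Plus[OF ix jy p] Comp_assoc[OF x i p] Comp_assoc[OF y j p] pi pj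
        Null_Comp[OF y X] Id_Comp[OF x] Plus_Null[OF x] by (simp add: s_def)
    have qs: "q \<cdot> s = y"
      using Comp_Plus[OF ix jy q] Comp_assoc[OF x i q] Comp_assoc[OF y j q] qj qi
        Null_Comp[OF x Y] Id_Comp[OF y] Null_Plus[OF y] by (simp add: s_def)
    have "r \<cdot> s = Null A W Z"
      using eq_iff[OF s] ps qs xy by simp
    then obtain u where u: "u \<in> Hom A W P" "k \<cdot> u = s"
      using kernel_factor[OF k(2) r(1) s] k(1) by (auto simp: Hom_def)
    show "\<exists>!u. u \<in> Hom A W P \<and> a \<cdot> u = x \<and> b \<cdot> u = y"
    proof
      show "u \<in> Hom A W P \<and> a \<cdot> u = x \<and> b \<cdot> u = y"
        using u ps qs Comp_assoc[OF u(1) k(1) p] Comp_assoc[OF u(1) k(1) q] by (simp add: a_def b_def)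
    next
      fix v
      assume v: "v \<in> Hom A W P \<and> a \<cdot> v = x \<and> b \<cdot> v = y"
      then have vH: "v \<in> Hom A W P"
        by simp
      have kv: "k \<cdot> v \<in> Hom A W S"
        using Comp_Hom vH k(1) by blast
      have "p \<cdot> (k \<cdot> v) = x" "q \<cdot> (k \<cdot> v) = y"
        using v Comp_assoc[OF vH k(1) p] Comp_assoc[OF vH k(1) q] by (auto simp: a_def b_def)
      then have "k \<cdot> v = s"
        using split[OF kv] by (simp add: s_def)
      then show "v = u"
        using u monic_cancel[OF k(3,1) vH] by simp
    qed
  next
    assume e: "epic A f"
    have ri: "r \<cdot> i = f"
    proof -
      have "Plus A (r \<cdot> i) (Null A X Z) = f"
        using Plus_Comp[OF i r(1) gq, folded r(2)] Comp_assoc[OF i p f] Comp_assoc[OF i q g]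
          pi qi Comp_Id[OF f] Comp_Null[OF g X] by simp
      then show ?thesis
        using Plus_Null[OF Comp_Hom[OF i r(1)]] by simp
    qed
    have er: "epic A r"
      using epic_Comp_left[OF _ i r(1)] ri e by simp
    have ck: "is_cokernel A r k"
      using kernel_of_epic_short_exact[OF r(1) er k(2)] by (simp add: short_exact_def)
    \<comment> \<open>As r i = f is epic, so is r, which is therefore the cokernel of k. If h kills
      b, then h q = t r for some t; restricting along i gives t f = 0, so t = 0, and restricting h q
      = 0 along j gives h = 0.\<close>
    have "h = Null A Y V" if h: "h \<in> Hom A Y V" "h \<cdot> b = Null A P V" for V h
    proof -
      have "(h \<cdot> q) \<cdot> k = Null A P V"
        using h(2) Comp_assoc[OF k(1) q h(1)] by (simp add: b_def)
      then obtain t where t: "t \<in> Hom A Z V" "t \<cdot> r = h \<cdot> q"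
        using cokernel_factor[OF ck k(1) Comp_Hom[OF q h(1)]] r(1) by (auto simp: Hom_def)
      have "t \<cdot> f = Null A X V"
        using Comp_assoc[OF i r(1) t(1)] ri t(2) Comp_assoc[OF i q h(1)] qi Comp_Null[OF h(1) X] by simp
      then have "t = Null A Z V"
        using epic_Null[OF e f t(1)] by simp
      then have "h \<cdot> q = Null A S V"
        using t(2) Null_Comp[OF r(1)] Hom_Ob[OF t(1)] by simp
      then have "h = Null A S V \<cdot> j"
        using Comp_assoc[OF j q h(1)] qj Comp_Id[OF h(1)] by simp
      then show ?thesis
        using Null_Comp[OF j] Hom_Ob[OF h(1)] by simp
    qed
    then show "epic A b"
      using epicI[OF b] by blast
  qed
qed

text \<open>
  Morphisms into an object serve as its generalized elements: along an epimorphism they lift after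
  passing to an epimorphic cover, which makes diagram chases possible.
\<close>

lemma epic_lift:
  assumes e: "e \<in> Hom A X Y" "epic A e" and y: "y \<in> Hom A W Y"
  obtains V w x where "w \<in> Hom A V W" "epic A w" "x \<in> Hom A V X" "e \<cdot> x = y \<cdot> w"
proof -
  obtain P a b where "a \<in> Hom A P X" "b \<in> Hom A P W" "e \<cdot> a = y \<cdot> b" "epic A b"
    by (rule pullback[OF e(1) y]) (use e(2) in blast)
  then show ?thesis
    using that by blast
qed

lemma epicI_lift:
  assumes e: "e \<in> Hom A X Y" and w: "w \<in> Hom A V Y" "epic A w" and x: "x \<in> Hom A V X" "e \<cdot> x = w"
  shows "epic A e"
  using epic_Comp_left[OF _ x(1) e] w x(2) by simp

end

section \<open>Short exact sequences, images and exactness on generalized elements\<close>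

context abelian_category
begin

lemma short_exactD:
  assumes "short_exact A f g" "f \<in> Hom A X Y" "g \<in> Hom A Y Z"
  shows "monic A f" "epic A g" "g \<cdot> f = Null A X Z" "is_kernel A f g" "is_cokernel A g f"
  using assms kernel_monic cokernel_epic cokernel_Null[of g f X Y]
  by (auto simp: short_exact_def Hom_def)

lemma short_exactI:
  assumes f: "f \<in> Hom A X Y" "monic A f" and g: "g \<in> Hom A Y Z" "epic A g"
    and gf: "g \<cdot> f = Null A X Z"
    and "\<And>W h. h \<in> Hom A W Y \<Longrightarrow> g \<cdot> h = Null A W Z \<Longrightarrow> \<exists>u\<in>Hom A W X. f \<cdot> u = h"
  shows "short_exact A f g"
  using kernel_of_epic_short_exact[OF g] kernelI[OF f(1) g(1) f(2) gf] assms(6) by blast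

lemma short_exact_factor:
  assumes "short_exact A f g" "f \<in> Hom A X Y" "g \<in> Hom A Y Z" "h \<in> Hom A W Y" "g \<cdot> h = Null A W Z"
  obtains u where "u \<in> Hom A W X" "f \<cdot> u = h"
  using kernel_factor[OF short_exactD(4)[OF assms(1-3)] assms(3-5)] assms(2) by (auto simp: Hom_def)

lemma short_exact_cofactor:
  assumes "short_exact A f g" "f \<in> Hom A X Y" "g \<in> Hom A Y Z" "h \<in> Hom A Y W" "h \<cdot> f = Null A X W"
  obtains u where "u \<in> Hom A Z W" "u \<cdot> g = h"
  using cokernel_factor[OF short_exactD(5)[OF assms(1-3)] assms(2,4,5)] assms(3) by (auto simp: Hom_def)

text \<open>Cancelling the epimorphism e shows that m and m e have the same cokernel.\<close>

lemma image_short_exact: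
  assumes e: "e \<in> Hom A X I" "epic A e" and m: "m \<in> Hom A I Y" "monic A m"
    and c: "c \<in> Hom A Y C" "is_cokernel A c (m \<cdot> e)"
  shows "short_exact A m c"
proof -
  have me: "m \<cdot> e \<in> Hom A X Y"
    using Comp_Hom[OF e(1) m(1)] .
  have "(c \<cdot> m) \<cdot> e = Null A X C"
    using cokernel_Null[OF c(2) me] c(1) Comp_assoc[OF e(1) m(1) c(1)] by (simp add: Hom_def)
  then have cm: "c \<cdot> m = Null A I C"
    using epic_Null[OF e(2,1) Comp_Hom[OF m(1) c(1)]] by simp
  have "\<exists>u\<in>Hom A C Z. u \<cdot> c = h" if h: "h \<in> Hom A Y Z" "h \<cdot> m = Null A I Z" for Z h
  proof -
    have "h \<cdot> (m \<cdot> e) = Null A X Z"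
      using Comp_assoc[OF e(1) m(1) h(1)] h(2) Null_Comp[OF e(1)] Hom_Ob[OF h(1)] by simp
    then show ?thesis
      using cokernel_factor[OF c(2) me h(1)] c(1) by (auto simp: Hom_def)
  qed
  then have "is_cokernel A c m"
    using cokernelI[OF c(1) m(1) cokernel_epic[OF c(2)] cm] by blast
  then show ?thesis
    using cokernel_of_monic_short_exact[OF m] by blast
qed

text \<open>Exactness at Y for generalized elements: what the cokernel kills lies in the image of f,
  and from the image it lifts to X after passing to a cover.\<close>

lemma exact_lift:
  assumes f: "f \<in> Hom A X Y" and c: "c \<in> Hom A Y C" "is_cokernel A c f"
    and h: "h \<in> Hom A W Y" "c \<cdot> h = Null A W C"
  obtains V w x where "w \<in> Hom A V W" "epic A w" "x \<in> Hom A V X" "f \<cdot> x = h \<cdot> w"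
proof -
  obtain I e m where e: "e \<in> Hom A X I" "epic A e" and m: "m \<in> Hom A I Y" "monic A m"
    and fme: "f = m \<cdot> e"
    using image_factorization[OF f] .
  have "short_exact A m c"
    using image_short_exact[OF e m c(1)] c(2) fme by simp
  then obtain t where t: "t \<in> Hom A W I" "m \<cdot> t = h"
    using short_exact_factor[OF _ m(1) c(1) h] by blast
  obtain V w x where w: "w \<in> Hom A V W" "epic A w" and x: "x \<in> Hom A V X" "e \<cdot> x = t \<cdot> w"
    using epic_lift[OF e t(1)] .
  have "f \<cdot> x = h \<cdot> w"
    unfolding fme Comp_assoc[OF x(1) e(1) m(1)] x(2) Comp_assoc[OF w(1) t(1) m(1), symmetric] t(2) ..
  then show ?thesis
    using that w x(1) by blast
qed

lemma kernel_monic_Comp: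
  assumes k: "k \<in> Hom A K X" "is_kernel A k g" and g: "g \<in> Hom A X Y" and m: "m \<in> Hom A Y Z" "monic A m"
  shows "is_kernel A k (m \<cdot> g)"
proof (rule kernelI[OF k(1) Comp_Hom[OF g m(1)] kernel_monic[OF k(2)]])
  have "g \<cdot> k = Null A K Y"
    using kernel_Null[OF k(2) g] k(1) by (simp add: Hom_def)
  then show "m \<cdot> g \<cdot> k = Null A K Z"
    using Comp_assoc[OF k(1) g m(1)] Comp_Null[OF m(1)] Hom_Ob[OF k(1)] by simp
next
  fix W h
  assume h: "h \<in> Hom A W X" "m \<cdot> g \<cdot> h = Null A W Z"
  then have "m \<cdot> (g \<cdot> h) = Null A W Z"
    using Comp_assoc[OF h(1) g m(1)] by simp
  then have "g \<cdot> h = Null A W Y"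
    using monic_Null[OF m(2,1) Comp_Hom[OF h(1) g]] by simp
  then show "\<exists>u\<in>Hom A W K. k \<cdot> u = h"
    using kernel_factor[OF k(2) g h(1)] k(1) by (auto simp: Hom_def)
qed

lemma monic_if_zero_kernel:
  assumes f: "f \<in> Hom A X Y" and k: "k \<in> Hom A K X" "is_kernel A k f" and K: "zero_object A K"
  shows "monic A f"
proof (rule monicI[OF f])
  fix W h
  assume h: "h \<in> Hom A W X" "f \<cdot> h = Null A W Y"
  then obtain u where u: "u \<in> Hom A W K" "k \<cdot> u = h"
    using kernel_factor[OF k(2) f h] k(1) by (auto simp: Hom_def)
  have "u = Null A W K"
    using Hom_zero_right[OF K u(1)] .
  then show "h = Null A W X"
    using u Comp_Null[OF k(1)] Hom_Ob[OF h(1)] by simp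
qed

lemma epic_if_zero_cokernel:
  assumes f: "f \<in> Hom A X Y" and c: "c \<in> Hom A Y C" "is_cokernel A c f" and C: "zero_object A C"
  shows "epic A f"
proof (rule epicI[OF f])
  fix W h
  assume h: "h \<in> Hom A Y W" "h \<cdot> f = Null A X W"
  then obtain u where u: "u \<in> Hom A C W" "u \<cdot> c = h"
    using cokernel_factor[OF c(2) f h] c(1) by (auto simp: Hom_def)
  have "u = Null A C W"
    using Hom_zero_left[OF C u(1)] .
  then show "h = Null A Y W"
    using u Null_Comp[OF c(1)] Hom_Ob[OF h(1)] by simp
qed

section \<open>Length\<close>

text \<open>A relation, since different series of one object are not compared with each other; it
  grows by one simple top factor at a time, so that induction can remove this factor.\<close>

inductive has_length :: "nat \<Rightarrow> 'a \<Rightarrow> bool" where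
  zero: "zero_object A X \<Longrightarrow> has_length 0 X"
| step: "i \<in> Hom A Y X \<Longrightarrow> p \<in> Hom A X S \<Longrightarrow> short_exact A i p \<Longrightarrow> has_length n Y
    \<Longrightarrow> simple_object A S \<Longrightarrow> has_length (Suc n) X"

lemma composition_series_has_length:
  assumes "composition_series A X n Y i p"
  shows "has_length n X"
proof -
  have "k \<le> n \<Longrightarrow> has_length k (Y k)" for k
  proof (induction k)
    case 0
    then show ?case
      using assms has_length.zero by (simp add: composition_series_def)
  next
    case (Suc k)
    have "i k \<in> Hom A (Y k) (Y (Suc k))" "short_exact A (i k) (p k)" "simple_object A (Cod A (p k))"
      using assms Suc.prems by (auto simp: composition_series_def)
    moreover from this have "p k \<in> Hom A (Y (Suc k)) (Cod A (p k))"
      using cokernel_Hom by (auto simp: short_exact_def)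
    ultimately show ?case
      using has_length.step Suc by simp
  qed
  then show ?thesis
    using assms by (auto simp: composition_series_def)
qed

lemma Hom_to_simple:
  assumes S: "simple_object A S" and f: "f \<in> Hom A X S"
  shows "f = Null A X S \<or> epic A f"
proof -
  obtain I e m where e: "e \<in> Hom A X I" "epic A e" and m: "m \<in> Hom A I S" "monic A m"
    and fme: "f = m \<cdot> e"
    using image_factorization[OF f] .
  have "zero_object A I \<or> is_iso A m"
    using S m by (auto simp: simple_object_def Hom_def)
  then show ?thesis
  proof
    assume "zero_object A I"
    then have "e = Null A X I"
      using Hom_zero_right e(1) by blast
    then show ?thesis
      using fme Comp_Null[OF m(1)] Hom_Ob[OF f] by simp
  next
    assume "is_iso A m"
    then show ?thesis
      using epic_Comp[OF e(2,1) iso_epic[OF _ m(1)] m(1)] fme by simp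
  qed
qed

text \<open>Intersect X with the penultimate term Y' of the series of Y. The simple top S is a
  quotient of Z when X lies in Y', and of X otherwise; removing it leaves a short exact sequence
  with middle term Y', to which the induction applies.\<close>

lemma has_length_short_exact:
  assumes "has_length n Y" "f \<in> Hom A X Y" "g \<in> Hom A Y Z" "short_exact A f g"
  shows "\<exists>a c. a + c = n \<and> has_length a X \<and> has_length c Z"
  using assms
proof (induction arbitrary: X Z f g rule: has_length.induct)
  case (zero Y)
  have "f = Null A X Y" "g = Null A Y Z"
    using zero Hom_zero_right Hom_zero_left by blast+
  then have "zero_object A X" "zero_object A Z"
    using monic_zero_imp epic_zero_imp zero short_exactD by blast+
  then show ?case
    using has_length.zero by fastforce
next
  case (step i Y' Y p S n)
  note i = step.hyps(1) and p = step.hyps(2) and ip = step.hyps(3)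
    and f = step.prems(1) and g = step.prems(2) and fg = step.prems(3)
  have pf: "p \<cdot> f \<in> Hom A X S"
    using Comp_Hom[OF f p] .
  have gi: "g \<cdot> i \<in> Hom A Y' Z"
    using Comp_Hom[OF i g] .
  note ipD = short_exactD[OF ip i p] and fgD = short_exactD[OF fg f g]
  from Hom_to_simple[OF step.hyps(5) pf] show ?case
  proof
    \<comment> \<open>Here X lies inside Y'. With C = Y'/X, the object Z is an extension of S by
      C.\<close>
    assume pf0: "p \<cdot> f = Null A X S"
    obtain f' where f': "f' \<in> Hom A X Y'" "i \<cdot> f' = f"
      using short_exact_factor[OF ip i p f pf0] .
    have f'm: "monic A f'"
      using monic_Comp_right[OF _ f'(1) i] f'(2) fgD(1) by simp
    obtain C c where c: "c \<in> Hom A Y' C" "is_cokernel A c f'" "epic A c" "c \<cdot> f' = Null A X C"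
      using obtain_cokernel[OF f'(1)] .
    have f'c: "short_exact A f' c"
      using cokernel_of_monic_short_exact[OF f'(1) f'm c(2)] .
    obtain a d where ad: "a + d = n" "has_length a X" "has_length d C"
      using step.IH[OF f'(1) c(1) f'c] by blast
    have "(g \<cdot> i) \<cdot> f' = Null A X Z"
      using Comp_assoc[OF f'(1) i g] f'(2) fgD(3) by simp
    then obtain h where h: "h \<in> Hom A C Z" "h \<cdot> c = g \<cdot> i"
      using short_exact_cofactor[OF f'c f'(1) c(1) gi] by blast
    obtain q where q: "q \<in> Hom A Z S" "q \<cdot> g = p"
      using short_exact_cofactor[OF fg f g p pf0] .
    have qe: "epic A q"
      using epic_Comp_left[OF _ g q(1)] q(2) ipD(2) by simp
    \<comment> \<open>If h kills x, lift x to y in Y' along c. Then g kills i y, so y comes from X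
      and c y = 0.\<close>
    have hm: "monic A h"
    proof (rule monicI[OF h(1)])
      fix W x
      assume x: "x \<in> Hom A W C" "h \<cdot> x = Null A W Z"
      obtain V w y where w: "w \<in> Hom A V W" "epic A w" and y: "y \<in> Hom A V Y'" "c \<cdot> y = x \<cdot> w"
        using epic_lift[OF c(1,3) x(1)] .
      have iy: "i \<cdot> y \<in> Hom A V Y"
        using Comp_Hom[OF y(1) i] .
      have "g \<cdot> (i \<cdot> y) = (h \<cdot> x) \<cdot> w"
        using Comp_assoc[OF y(1) i g] h(2) Comp_assoc[OF y(1) c(1) h(1)] y(2)
          Comp_assoc[OF w(1) x(1) h(1)] by metis
      then have "g \<cdot> (i \<cdot> y) = Null A V Z"
        using x(2) Null_Comp[OF w(1)] Hom_Ob[OF h(1)] by simp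
      then obtain u where u: "u \<in> Hom A V X" "f \<cdot> u = i \<cdot> y"
        using short_exact_factor[OF fg f g iy] by blast
      have "i \<cdot> (f' \<cdot> u) = i \<cdot> y"
        using Comp_assoc[OF u(1) f'(1) i] f'(2) u(2) by simp
      then have "y = f' \<cdot> u"
        using monic_cancel[OF ipD(1) i Comp_Hom[OF u(1) f'(1)] y(1)] by simp
      then have "x \<cdot> w = (c \<cdot> f') \<cdot> u"
        using y(2) Comp_assoc[OF u(1) f'(1) c(1)] by simp
      then have "x \<cdot> w = Null A V C"
        using c(4) Null_Comp[OF u(1)] Hom_Ob[OF c(1)] by simp
      then show "x = Null A W C"
        using epic_Null[OF w(2,1) x(1)] by simp
    qed
    have "(q \<cdot> h) \<cdot> c = Null A Y' S"
      using Comp_assoc[OF c(1) h(1) q(1)] h(2) Comp_assoc[OF i g q(1)] q(2) ipD(3) by simp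
    then have qh: "q \<cdot> h = Null A C S"
      using epic_Null[OF c(3,1) Comp_Hom[OF h(1) q(1)]] by simp
    \<comment> \<open>If q kills x, lift x to b in Y along g. Then p kills b, so b comes from Y'.
      The factorization through h obtained on the cover descends because h is monic.\<close>
    have "\<exists>u\<in>Hom A W C. h \<cdot> u = x" if x: "x \<in> Hom A W Z" "q \<cdot> x = Null A W S" for W x
    proof -
      obtain V w b where w: "w \<in> Hom A V W" "epic A w" and b: "b \<in> Hom A V Y" "g \<cdot> b = x \<cdot> w"
        using epic_lift[OF g fgD(2) x(1)] .
      have "p \<cdot> b = (q \<cdot> x) \<cdot> w"
        using Comp_assoc[OF b(1) g q(1)] q(2) b(2) Comp_assoc[OF w(1) x(1) q(1)] by simp
      then have "p \<cdot> b = Null A V S"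
        using x(2) Null_Comp[OF w(1)] Hom_Ob[OF p] by simp
      then obtain y where y: "y \<in> Hom A V Y'" "i \<cdot> y = b"
        using short_exact_factor[OF ip i p b(1)] by blast
      have "x \<cdot> w = h \<cdot> (c \<cdot> y)"
        using b(2) y(2) Comp_assoc[OF y(1) i g] h(2) Comp_assoc[OF y(1) c(1) h(1)] by metis
      then show ?thesis
        using monic_factor_epic[OF h(1) hm x(1) w Comp_Hom[OF y(1) c(1)]] by blast
    qed
    then have "short_exact A h q"
      using short_exactI[OF h(1) hm q(1) qe qh] by blast
    then have "has_length (Suc d) Z"
      using has_length.step[OF h(1) q(1) _ ad(3) step.hyps(5)] by blast
    then show ?case
      using ad by (intro exI[of _ a] exI[of _ "Suc d"]) simp
  next
    \<comment> \<open>K plays the role of the intersection of X and Y': the quotient of X by K is S,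
      and Y' already maps onto Z with kernel K.\<close>
    assume pfe: "epic A (p \<cdot> f)"
    obtain K k where k: "k \<in> Hom A K X" "is_kernel A k (p \<cdot> f)" "monic A k" "p \<cdot> f \<cdot> k = Null A K S"
      using obtain_kernel[OF pf] .
    have fk: "f \<cdot> k \<in> Hom A K Y"
      using Comp_Hom[OF k(1) f] .
    have "p \<cdot> (f \<cdot> k) = Null A K S"
      using k(4) Comp_assoc[OF k(1) f p] by simp
    then obtain j where j: "j \<in> Hom A K Y'" "i \<cdot> j = f \<cdot> k"
      using short_exact_factor[OF ip i p fk] by blast
    have "monic A (i \<cdot> j)"
      using monic_Comp[OF k(3,1) fgD(1) f] j(2) by simp
    then have jm: "monic A j"
      using monic_Comp_right j(1) i by blast
    have gij: "(g \<cdot> i) \<cdot> j = Null A K Z"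
      using Comp_assoc[OF j(1) i g] j(2) Comp_assoc[OF k(1) f g] fgD(3) Null_Comp[OF k(1)] Hom_Ob[OF g]
      by simp
    \<comment> \<open>A morphism on Z that kills the image of Y' factors, after composing with g,
      through S. It vanishes on X, which maps onto S, hence it is zero.\<close>
    have gie: "epic A (g \<cdot> i)"
    proof (rule epicI[OF gi])
      fix W h
      assume h: "h \<in> Hom A Z W" "h \<cdot> (g \<cdot> i) = Null A Y' W"
      have hg: "h \<cdot> g \<in> Hom A Y W"
        using Comp_Hom[OF g h(1)] .
      have "(h \<cdot> g) \<cdot> i = Null A Y' W"
        using h(2) Comp_assoc[OF i g h(1)] by simp
      then obtain s where s: "s \<in> Hom A S W" "s \<cdot> p = h \<cdot> g"
        using short_exact_cofactor[OF ip i p hg] by blast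
      have "s \<cdot> (p \<cdot> f) = Null A X W"
        using Comp_assoc[OF f p s(1)] s(2) Comp_assoc[OF f g h(1)] fgD(3) Comp_Null[OF h(1)]
          Hom_Ob[OF f] by simp
      then have "s = Null A S W"
        using epic_Null[OF pfe pf s(1)] by simp
      then have "h \<cdot> g = Null A Y W"
        using s(2) Null_Comp[OF p] Hom_Ob[OF h(1)] by simp
      then show "h = Null A Z W"
        using epic_Null[OF fgD(2) g h(1)] by simp
    qed
    have "\<exists>u\<in>Hom A W K. j \<cdot> u = y" if y: "y \<in> Hom A W Y'" "(g \<cdot> i) \<cdot> y = Null A W Z" for W y
    proof -
      have iy: "i \<cdot> y \<in> Hom A W Y"
        using Comp_Hom[OF y(1) i] .
      have "g \<cdot> (i \<cdot> y) = Null A W Z"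
        using Comp_assoc[OF y(1) i g] y(2) by simp
      then obtain a where a: "a \<in> Hom A W X" "f \<cdot> a = i \<cdot> y"
        using short_exact_factor[OF fg f g iy] by blast
      have "(p \<cdot> f) \<cdot> a = Null A W S"
        using Comp_assoc[OF a(1) f p] a(2) Comp_assoc[OF y(1) i p] ipD(3) Null_Comp[OF y(1)]
          Hom_Ob[OF p] by simp
      then obtain u where u: "u \<in> Hom A W K" "k \<cdot> u = a"
        using kernel_factor[OF k(2) pf a(1)] k(1) by (auto simp: Hom_def)
      have "i \<cdot> (j \<cdot> u) = i \<cdot> y"
        using Comp_assoc[OF u(1) j(1) i] j(2) Comp_assoc[OF u(1) k(1) f] u(2) a(2) by simp
      then have "j \<cdot> u = y"
        using monic_cancel[OF ipD(1) i Comp_Hom[OF u(1) j(1)] y(1)] by simp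
      then show ?thesis
        using u(1) by blast
    qed
    then have "short_exact A j (g \<cdot> i)"
      using short_exactI[OF j(1) jm gi gie gij] by blast
    then obtain a c where ac: "a + c = n" "has_length a K" "has_length c Z"
      using step.IH[OF j(1) gi] by blast
    have "has_length (Suc a) X"
      using has_length.step[OF k(1) pf kernel_of_epic_short_exact[OF pf pfe k(2)] ac(2) step.hyps(5)] .
    then show ?case
      using ac by (intro exI[of _ "Suc a"] exI[of _ c]) simp
  qed
qed

text \<open>
  Superadditivity of this length is all that is needed, so the Jordan--Hoelder theorem is avoided by
  taking the minimal length of a composition series.
\<close>

definition obj_length :: "'a \<Rightarrow> nat" where
  "obj_length X = (LEAST n. has_length n X)"

end

context abelian_length_category
begin

lemma has_obj_length: "X \<in> Ob A \<Longrightarrow> has_length (obj_length X) X"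
  unfolding obj_length_def
  using ex_composition_series composition_series_has_length LeastI_ex[of "\<lambda>n. has_length n X"] by metis

lemma obj_length_short_exact:
  assumes "short_exact A f g" "f \<in> Hom A X Y" "g \<in> Hom A Y Z"
  shows "obj_length X + obj_length Z \<le> obj_length Y"
proof -
  obtain a c where "a + c = obj_length Y" "has_length a X" "has_length c Z"
    using has_length_short_exact[OF has_obj_length assms(2,3,1)] Hom_Ob[OF assms(2)] by blast
  moreover from this have "obj_length X \<le> a" "obj_length Z \<le> c"
    by (auto simp: obj_length_def intro: Least_le)
  ultimately show ?thesis
    by simp
qed

lemma obj_length_pos: "X \<in> Ob A \<Longrightarrow> \<not> zero_object A X \<Longrightarrow> 0 < obj_length X"
  using has_obj_length[of X] by (auto elim: has_length.cases)

text \<open>If the cokernel is zero, m is also epic and hence iso; otherwise the cokernel takes up a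
  positive part of the length of Y.\<close>

lemma monic_iso_or_shorter:
  assumes m: "m \<in> Hom A X Y" "monic A m"
  shows "is_iso A m \<or> obj_length X < obj_length Y"
proof -
  obtain C c where c: "c \<in> Hom A Y C" "is_cokernel A c m"
    using obtain_cokernel[OF m(1)] .
  show ?thesis
  proof (cases "zero_object A C")
    case True
    then show ?thesis
      using monic_epic_iso[OF m] epic_if_zero_cokernel[OF m(1) c] by blast
  next
    case False
    then show ?thesis
      using obj_length_short_exact[OF cokernel_of_monic_short_exact[OF m c(2)] m(1) c(1)]
        obj_length_pos Hom_Ob[OF c(1)] by fastforce
  qed
qed

lemma epic_iso_or_shorter:
  assumes e: "e \<in> Hom A X Y" "epic A e"
  shows "is_iso A e \<or> obj_length Y < obj_length X"
proof -
  obtain K k where k: "k \<in> Hom A K X" "is_kernel A k e"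
    using obtain_kernel[OF e(1)] .
  show ?thesis
  proof (cases "zero_object A K")
    case True
    then show ?thesis
      using monic_epic_iso[OF e(1) _ e(2)] monic_if_zero_kernel[OF e(1) k] by blast
  next
    case False
    then show ?thesis
      using obj_length_short_exact[OF kernel_of_epic_short_exact[OF e k(2)] k(1) e(1)]
        obj_length_pos Hom_Ob[OF k(1)] by fastforce
  qed
qed

end

section \<open>Torsion classes\<close>

context abelian_category
begin

lemma torsI:
  assumes "\<T> \<subseteq> Ob A" "\<T> \<noteq> {}"
    and "\<And>f X Y. f \<in> Hom A X Y \<Longrightarrow> epic A f \<Longrightarrow> X \<in> \<T> \<Longrightarrow> Y \<in> \<T>"
    and "\<And>f g X Y Z. f \<in> Hom A X Y \<Longrightarrow> g \<in> Hom A Y Z \<Longrightarrow> short_exact A f g \<Longrightarrow> X \<in> \<T> \<Longrightarrow> Z \<in> \<T>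
      \<Longrightarrow> Y \<in> \<T>"
  shows "\<T> \<in> tors A"
proof -
  have "subcategory A \<T>"
    unfolding subcategory_def using assms(1,3) iso_objs_epic by metis
  moreover have "closed_factors A \<T>"
    unfolding closed_factors_def
  proof (intro allI impI, elim conjE)
    fix f
    assume f: "epic A f" "Dom A f \<in> \<T>"
    then have "f \<in> Hom A (Dom A f) (Cod A f)"
      by (simp add: epic_def Hom_def)
    then show "Cod A f \<in> \<T>"
      using assms(3) f by blast
  qed
  moreover have "closed_extensions A \<T>"
    unfolding closed_extensions_def
  proof (intro allI impI, elim conjE)
    fix f g
    assume *: "short_exact A f g" "Dom A f \<in> \<T>" "Cod A g \<in> \<T>"
    then have "f \<in> Hom A (Dom A f) (Cod A f)" "g \<in> Hom A (Cod A f) (Cod A g)"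
      by (auto simp: short_exact_def is_kernel_def Hom_def)
    then show "Cod A f \<in> \<T>"
      using assms(4) * by blast
  qed
  ultimately show ?thesis
    using assms(2) by (simp add: tors_def torsion_class_def)
qed

lemma tors_Ob: "\<T> \<in> tors A \<Longrightarrow> X \<in> \<T> \<Longrightarrow> X \<in> Ob A"
  by (auto simp: tors_def torsion_class_def subcategory_def)

lemma tors_epic: "\<T> \<in> tors A \<Longrightarrow> f \<in> Hom A X Y \<Longrightarrow> epic A f \<Longrightarrow> X \<in> \<T> \<Longrightarrow> Y \<in> \<T>"
  by (auto simp: tors_def torsion_class_def closed_factors_def Hom_def)

lemma tors_extension:
  assumes "\<T> \<in> tors A" "short_exact A f g" "f \<in> Hom A X Y" "g \<in> Hom A Y Z" "X \<in> \<T>" "Z \<in> \<T>"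
  shows "Y \<in> \<T>"
proof -
  have "Dom A f = X" "Cod A f = Y" "Cod A g = Z"
    using assms(3,4) by (auto simp: Hom_def)
  then show ?thesis
    using assms unfolding tors_def torsion_class_def closed_extensions_def by blast
qed

lemma tors_epic_extension:
  assumes "\<T> \<in> tors A" "g \<in> Hom A Y Z" "epic A g" "k \<in> Hom A K Y" "is_kernel A k g" "K \<in> \<T>" "Z \<in> \<T>"
  shows "Y \<in> \<T>"
  using tors_extension[OF assms(1) kernel_of_epic_short_exact[OF assms(2,3,5)] assms(4,2,6,7)] .

lemma tors_zero:
  assumes "\<T> \<in> tors A" "zero_object A Z"
  shows "Z \<in> \<T>"
proof -
  obtain X where "X \<in> \<T>"
    using assms(1) by (auto simp: tors_def torsion_class_def)
  moreover from this obtain f where "f \<in> Hom A X Z"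
    using assms tors_Ob Null_Hom zero_object_iff by blast
  ultimately show ?thesis
    using tors_epic assms epic_to_zero by blast
qed

lemma tors_Inter:
  assumes "\<M> \<subseteq> tors A" "\<M> \<noteq> {}"
  shows "\<Inter>\<M> \<in> tors A"
proof (rule torsI)
  show "\<Inter>\<M> \<subseteq> Ob A"
    using assms tors_Ob by blast
  show "\<Inter>\<M> \<noteq> {}"
  proof -
    obtain Z where "zero_object A Z"
      using obtain_zero_object .
    then have "Z \<in> \<Inter>\<M>"
      using assms(1) tors_zero by blast
    then show ?thesis
      by blast
  qed
next
  fix f X Y
  assume "f \<in> Hom A X Y" "epic A f" "X \<in> \<Inter>\<M>"
  then show "Y \<in> \<Inter>\<M>"
    using assms tors_epic by blast
next
  fix f g X Y Z
  assume "f \<in> Hom A X Y" "g \<in> Hom A Y Z" "short_exact A f g" "X \<in> \<Inter>\<M>" "Z \<in> \<Inter>\<M>"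
  then show "Y \<in> \<Inter>\<M>"
    using assms tors_extension by blast
qed

lemma Ob_tors: "Ob A \<in> tors A"
proof (rule torsI)
  show "Ob A \<noteq> {}"
    using obtain_zero_object by blast
qed (use Hom_Ob in \<open>blast+\<close>)

lemma tors_gen_tors:
  assumes "\<X> \<subseteq> Ob A"
  shows "tors_gen A \<X> \<in> tors A"
proof -
  \<comment> \<open>\<open>Ob A\<close> keeps the family intersected by the hull nonempty; an
    intersection over no sets would be the whole type.\<close>
  from assms have "Ob A \<in> {\<T>. torsion_class A \<T> \<and> \<X> \<subseteq> \<T>}"
    using Ob_tors by (simp add: tors_def)
  moreover have "{\<T>. torsion_class A \<T> \<and> \<X> \<subseteq> \<T>} \<subseteq> tors A"
    unfolding tors_def by blast
  ultimately show ?thesis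
    unfolding tors_gen_def hull_def using tors_Inter by blast
qed

lemma tors_gen_subset: "\<X> \<subseteq> tors_gen A \<X>"
  by (simp add: tors_gen_def hull_subset)

lemma tors_gen_minimal: "\<T> \<in> tors A \<Longrightarrow> \<X> \<subseteq> \<T> \<Longrightarrow> tors_gen A \<X> \<subseteq> \<T>"
  by (simp add: tors_gen_def tors_def hull_minimal)

lemma tors_gen_mono: "\<X> \<subseteq> \<Y> \<Longrightarrow> tors_gen A \<X> \<subseteq> tors_gen A \<Y>"
  by (simp add: tors_gen_def hull_mono)

text \<open>The part of T that is left orthogonal to S. All lower covers of T turn out to have this
  form.\<close>

definition no_maps_to :: "'a set \<Rightarrow> 'a \<Rightarrow> 'a set" where
  "no_maps_to \<T> S = {X \<in> \<T>. \<forall>f\<in>Hom A X S. f = Null A X S}"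

lemma no_maps_to_subset: "no_maps_to \<T> S \<subseteq> \<T>"
  by (simp add: no_maps_to_def)

lemma no_maps_toD: "X \<in> no_maps_to \<T> S \<Longrightarrow> f \<in> Hom A X S \<Longrightarrow> f = Null A X S"
  unfolding no_maps_to_def by blast

lemma no_maps_toI:
  "X \<in> \<T> \<Longrightarrow> (\<And>f. f \<in> Hom A X S \<Longrightarrow> f = Null A X S) \<Longrightarrow> X \<in> no_maps_to \<T> S"
  unfolding no_maps_to_def by blast

lemma no_maps_to_tors:
  assumes T: "\<T> \<in> tors A" and S: "S \<in> Ob A"
  shows "no_maps_to \<T> S \<in> tors A"
proof (rule torsI)
  show "no_maps_to \<T> S \<subseteq> Ob A"
    using no_maps_to_subset tors_Ob[OF T] by blast
  show "no_maps_to \<T> S \<noteq> {}"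
  proof -
    obtain Z where Z: "zero_object A Z"
      using obtain_zero_object .
    have "Z \<in> no_maps_to \<T> S"
      using no_maps_toI[OF tors_zero[OF T Z] Hom_zero_left[OF Z]] .
    then show ?thesis
      by blast
  qed
next
  fix f X Y
  assume f: "f \<in> Hom A X Y" "epic A f" and X: "X \<in> no_maps_to \<T> S"
  have "h = Null A Y S" if h: "h \<in> Hom A Y S" for h
  proof -
    have "h \<cdot> f = Null A X S"
      using no_maps_toD[OF X Comp_Hom[OF f(1) h]] .
    then show ?thesis
      using epic_Null[OF f(2,1) h] by simp
  qed
  then show "Y \<in> no_maps_to \<T> S"
    using no_maps_toI tors_epic[OF T f] X no_maps_to_subset by blast
next
  fix f g X Y Z
  assume f: "f \<in> Hom A X Y" and g: "g \<in> Hom A Y Z" and fg: "short_exact A f g"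
    and X: "X \<in> no_maps_to \<T> S" and Z: "Z \<in> no_maps_to \<T> S"
  have "h = Null A Y S" if h: "h \<in> Hom A Y S" for h
  proof -
    have "h \<cdot> f = Null A X S"
      using no_maps_toD[OF X Comp_Hom[OF f h]] .
    then obtain u where u: "u \<in> Hom A Z S" "u \<cdot> g = h"
      using short_exact_cofactor[OF fg f g h] by blast
    then have "u = Null A Z S"
      using no_maps_toD[OF Z] by blast
    then show ?thesis
      using u(2) Null_Comp[OF g S] by simp
  qed
  then show "Y \<in> no_maps_to \<T> S"
    using no_maps_toI tors_extension[OF T fg f g] X Z no_maps_to_subset by blast
qed

section \<open>Wideness of W_L(T)\<close>

lemma W_L_iff:
  "X \<in> W_L A \<T> \<longleftrightarrow> X \<in> \<T> \<and>
    (\<forall>Y\<in>\<T>. \<forall>g\<in>Hom A Y X. \<forall>K. \<forall>k\<in>Hom A K Y. is_kernel A k g \<longrightarrow> K \<in> \<T>)"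
proof -
  have "(\<forall>k. is_kernel A k g \<longrightarrow> Dom A k \<in> \<T>)
      \<longleftrightarrow> (\<forall>K. \<forall>k\<in>Hom A K Y. is_kernel A k g \<longrightarrow> K \<in> \<T>)" if "g \<in> Hom A Y X" for g Y
    using kernel_Hom[OF _ that] by (auto simp: Hom_def)
  then show ?thesis
    unfolding W_L_def by blast
qed

lemma W_LD:
  assumes "X \<in> W_L A \<T>" "Y \<in> \<T>" "g \<in> Hom A Y X" "k \<in> Hom A K Y" "is_kernel A k g"
  shows "K \<in> \<T>"
  using assms unfolding W_L_iff by blast

lemma W_LI:
  assumes "X \<in> \<T>"
    and "\<And>Y g K k. Y \<in> \<T> \<Longrightarrow> g \<in> Hom A Y X \<Longrightarrow> k \<in> Hom A K Y \<Longrightarrow> is_kernel A k g \<Longrightarrow> K \<in> \<T>"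
  shows "X \<in> W_L A \<T>"
  using assms unfolding W_L_iff by blast

lemma W_L_subset: "W_L A \<T> \<subseteq> \<T>"
  by (auto simp: W_L_def)

text \<open>Composing g with the monomorphism m leaves its kernel unchanged, so the kernel condition
  passes from X to I.\<close>

lemma W_L_subobject:
  assumes X: "X \<in> W_L A \<T>" and I: "I \<in> \<T>" and m: "m \<in> Hom A I X" "monic A m"
  shows "I \<in> W_L A \<T>"
proof (rule W_LI[OF I])
  fix Y g K k
  assume Y: "Y \<in> \<T>" and g: "g \<in> Hom A Y I" and k: "k \<in> Hom A K Y" "is_kernel A k g"
  show "K \<in> \<T>"
    using W_LD[OF X Y Comp_Hom[OF g m(1)] k(1) kernel_monic_Comp[OF k g m]] .
qed

text \<open>The identity of Y factors through k, so K is isomorphic to Y.\<close>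

lemma kernel_of_Null_tors:
  assumes T: "\<T> \<in> tors A" and Y: "Y \<in> \<T>" and k: "k \<in> Hom A K Y" "is_kernel A k (Null A Y X)"
    and X: "X \<in> Ob A"
  shows "K \<in> \<T>"
proof -
  have YO: "Y \<in> Ob A"
    using T Y tors_Ob by blast
  note Id = Id_Hom[OF YO] and n = Null_Hom[OF YO X]
  obtain u where u: "u \<in> Hom A Y K" "k \<cdot> u = Id A Y"
    using kernel_factor[OF k(2) n Id] Null_Comp[OF Id X] k(1) by (auto simp: Hom_def)
  have "epic A k"
    using epic_Comp_left[OF _ u(1) k(1)] u(2) epic_Id[OF YO] by simp
  then have "is_iso A k"
    using monic_epic_iso[OF k(1) kernel_monic[OF k(2)]] by blast
  then obtain f where "f \<in> Hom A Y K" "epic A f"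
    using k(1) iso_objs_sym iso_objs_epic unfolding iso_objs_def by metis
  then show ?thesis
    using tors_epic[OF T] Y by blast
qed

lemma W_L_zero:
  assumes T: "\<T> \<in> tors A" and Z: "zero_object A Z"
  shows "Z \<in> W_L A \<T>"
proof (rule W_LI[OF tors_zero[OF T Z]])
  fix Y g K k
  assume *: "Y \<in> \<T>" "g \<in> Hom A Y Z" "k \<in> Hom A K Y" "is_kernel A k g"
  then have "g = Null A Y Z"
    using Hom_zero_right Z by blast
  then show "K \<in> \<T>"
    using kernel_of_Null_tors[OF T] * Hom_Ob by blast
qed

text \<open>Pull c back along g. The pullback P is an extension of Z by the image I of f, so it lies
  in T; the kernel of its projection to Y is again K, and Y in W_L(T) puts K into T.\<close>

lemma W_L_cokernel:
  assumes T: "\<T> \<in> tors A" and X: "X \<in> \<T>" and Y: "Y \<in> W_L A \<T>"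
    and f: "f \<in> Hom A X Y" and c: "c \<in> Hom A Y C" "is_cokernel A c f"
  shows "C \<in> W_L A \<T>"
proof (rule W_LI)
  have ce: "epic A c"
    using cokernel_epic[OF c(2)] .
  have YT: "Y \<in> \<T>"
    using Y W_L_subset by blast
  show "C \<in> \<T>"
    using tors_epic[OF T c(1) ce YT] .
  fix Z g K k
  assume Z: "Z \<in> \<T>" and g: "g \<in> Hom A Z C" and k: "k \<in> Hom A K Z" "is_kernel A k g"
  obtain P a b where a: "a \<in> Hom A P Y" and b: "b \<in> Hom A P Z" and cagb: "c \<cdot> a = g \<cdot> b"
    and univ: "\<And>W x y. x \<in> Hom A W Y \<Longrightarrow> y \<in> Hom A W Z \<Longrightarrow> c \<cdot> x = g \<cdot> y \<Longrightarrow>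
      \<exists>!u. u \<in> Hom A W P \<and> a \<cdot> u = x \<and> b \<cdot> u = y" and be: "epic A b"
    by (rule pullback[OF c(1) g]) (use ce in blast)
  have cg: "c \<cdot> (a \<cdot> h) = g \<cdot> (b \<cdot> h)" if h: "h \<in> Hom A W P" for h W
    using Comp_assoc[OF h a c(1)] Comp_assoc[OF h b g] cagb by simp
  have OC: "C \<in> Ob A" "Y \<in> Ob A" "Z \<in> Ob A"
    using Hom_Ob[OF c(1)] Hom_Ob[OF g] by auto
  obtain I e m where e: "e \<in> Hom A X I" "epic A e" and m: "m \<in> Hom A I Y" "monic A m"
    and fme: "f = m \<cdot> e"
    using image_factorization[OF f] .
  have mc: "short_exact A m c"
    using image_short_exact[OF e m c(1)] c(2) fme by simp
  have IT: "I \<in> \<T>"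
    using tors_epic[OF T e X] .
  have OI: "I \<in> Ob A"
    using Hom_Ob[OF m(1)] by simp
  have cm: "c \<cdot> m = g \<cdot> Null A I Z"
    using short_exactD(3)[OF mc m(1) c(1)] Comp_Null[OF g OI] by simp
  \<comment> \<open>With components m in Y and 0 in Z, this l is the kernel of b.\<close>
  obtain l where l: "l \<in> Hom A I P" "a \<cdot> l = m" "b \<cdot> l = Null A I Z"
    using univ[OF m(1) Null_Hom[OF OI OC(3)] cm] by blast
  have lm: "monic A l"
    using monic_Comp_right[OF _ l(1) a] l(2) m(2) by simp
  have "\<exists>u\<in>Hom A W I. l \<cdot> u = h" if h: "h \<in> Hom A W P" "b \<cdot> h = Null A W Z" for W h
  proof -
    have OW: "W \<in> Ob A"
      using Hom_Ob[OF h(1)] by simp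
    have ah: "a \<cdot> h \<in> Hom A W Y"
      using Comp_Hom[OF h(1) a] .
    have "c \<cdot> (a \<cdot> h) = Null A W C"
      using cg[OF h(1)] h(2) Comp_Null[OF g OW] by simp
    then obtain u where u: "u \<in> Hom A W I" "m \<cdot> u = a \<cdot> h"
      using short_exact_factor[OF mc m(1) c(1) ah] by blast
    have lu: "l \<cdot> u \<in> Hom A W P"
      using Comp_Hom[OF u(1) l(1)] .
    have "a \<cdot> (l \<cdot> u) = a \<cdot> h" "b \<cdot> (l \<cdot> u) = b \<cdot> h"
      using Comp_assoc[OF u(1) l(1) a] Comp_assoc[OF u(1) l(1) b] l u(2) h(2)
        Null_Comp[OF u(1) OC(3)] by auto
    then have "l \<cdot> u = h"
      using univ[OF ah Comp_Hom[OF h(1) b] cg[OF h(1)]] lu h(1) by blast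
    then show ?thesis
      using u(1) by blast
  qed
  then have "short_exact A l b"
    using short_exactI[OF l(1) lm b be l(3)] by blast
  then have PT: "P \<in> \<T>"
    using tors_extension[OF T _ l(1) b IT Z] by blast
  have OK: "K \<in> Ob A"
    using Hom_Ob[OF k(1)] by simp
  have "c \<cdot> Null A K Y = g \<cdot> k"
    using kernel_Null[OF k(2) g] k(1) Comp_Null[OF c(1) OK] by (simp add: Hom_def)
  \<comment> \<open>With components 0 in Y and k in Z, this k' is the kernel of a.\<close>
  then obtain k' where k': "k' \<in> Hom A K P" "a \<cdot> k' = Null A K Y" "b \<cdot> k' = k"
    using univ[OF Null_Hom[OF OK OC(2)] k(1)] by blast
  have k'm: "monic A k'"
    using monic_Comp_right[OF _ k'(1) b] k'(3) kernel_monic[OF k(2)] by simp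
  have "\<exists>u\<in>Hom A W K. k' \<cdot> u = h" if h: "h \<in> Hom A W P" "a \<cdot> h = Null A W Y" for W h
  proof -
    have OW: "W \<in> Ob A"
      using Hom_Ob[OF h(1)] by simp
    have bh: "b \<cdot> h \<in> Hom A W Z"
      using Comp_Hom[OF h(1) b] .
    have "g \<cdot> (b \<cdot> h) = Null A W C"
      using cg[OF h(1)] h(2) Comp_Null[OF c(1) OW] by simp
    then obtain u where u: "u \<in> Hom A W K" "k \<cdot> u = b \<cdot> h"
      using kernel_factor[OF k(2) g bh] k(1) by (auto simp: Hom_def)
    have ku: "k' \<cdot> u \<in> Hom A W P"
      using Comp_Hom[OF u(1) k'(1)] .
    have "a \<cdot> (k' \<cdot> u) = a \<cdot> h" "b \<cdot> (k' \<cdot> u) = b \<cdot> h"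
      using Comp_assoc[OF u(1) k'(1) a] Comp_assoc[OF u(1) k'(1) b] k' u(2) h(2)
        Null_Comp[OF u(1) OC(2)] by auto
    then have "k' \<cdot> u = h"
      using univ[OF Comp_Hom[OF h(1) a] bh cg[OF h(1)]] ku h(1) by blast
    then show ?thesis
      using u(1) by blast
  qed
  then have "is_kernel A k' a"
    using kernelI[OF k'(1) a k'm k'(2)] by blast
  then show "K \<in> \<T>"
    using W_LD[OF Y PT a k'(1)] by blast
qed

text \<open>The kernel of g is taken in two stages. The kernel N of q g lies in T because of Z; g
  maps N into X by t, and the kernel of t is K, which lies in T because of X.\<close>

lemma W_L_extension:
  assumes T: "\<T> \<in> tors A" and X: "X \<in> W_L A \<T>" and Z: "Z \<in> W_L A \<T>"
    and i: "i \<in> Hom A X Y" and q: "q \<in> Hom A Y Z" and iq: "short_exact A i q"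
  shows "Y \<in> W_L A \<T>"
proof (rule W_LI)
  show "Y \<in> \<T>"
    using tors_extension[OF T iq i q] X Z W_L_subset by blast
  fix V g K k
  assume V: "V \<in> \<T>" and g: "g \<in> Hom A V Y" and k: "k \<in> Hom A K V" "is_kernel A k g"
  note iqD = short_exactD[OF iq i q]
  have qg: "q \<cdot> g \<in> Hom A V Z"
    using Comp_Hom[OF g q] .
  obtain N n where n: "n \<in> Hom A N V" "is_kernel A n (q \<cdot> g)" "monic A n" "q \<cdot> g \<cdot> n = Null A N Z"
    using obtain_kernel[OF qg] .
  have NT: "N \<in> \<T>"
    using W_LD[OF Z V qg n(1,2)] .
  have "q \<cdot> (g \<cdot> n) = Null A N Z"
    using n(4) Comp_assoc[OF n(1) g q] by simp
  then obtain t where t: "t \<in> Hom A N X" "i \<cdot> t = g \<cdot> n"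
    using short_exact_factor[OF iq i q Comp_Hom[OF n(1) g]] by blast
  have OK: "K \<in> Ob A"
    using Hom_Ob[OF k(1)] by simp
  have gk: "g \<cdot> k = Null A K Y"
    using kernel_Null[OF k(2) g] k(1) by (simp add: Hom_def)
  then have "(q \<cdot> g) \<cdot> k = Null A K Z"
    using Comp_assoc[OF k(1) g q] Comp_Null[OF q OK] by simp
  then obtain k' where k': "k' \<in> Hom A K N" "n \<cdot> k' = k"
    using kernel_factor[OF n(2) qg k(1)] n(1) by (auto simp: Hom_def)
  have k'm: "monic A k'"
    using monic_Comp_right[OF _ k'(1) n(1)] k'(2) kernel_monic[OF k(2)] by simp
  have "i \<cdot> (t \<cdot> k') = Null A K Y"
    using Comp_assoc[OF k'(1) t(1) i] t(2) Comp_assoc[OF k'(1) n(1) g] k'(2) gk by simp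
  then have tk': "t \<cdot> k' = Null A K X"
    using monic_Null[OF iqD(1) i Comp_Hom[OF k'(1) t(1)]] by simp
  have "\<exists>u\<in>Hom A W K. k' \<cdot> u = h" if h: "h \<in> Hom A W N" "t \<cdot> h = Null A W X" for W h
  proof -
    have nh: "n \<cdot> h \<in> Hom A W V"
      using Comp_Hom[OF h(1) n(1)] .
    have "g \<cdot> (n \<cdot> h) = Null A W Y"
      using Comp_assoc[OF h(1) n(1) g] t(2)[symmetric] Comp_assoc[OF h(1) t(1) i] h(2)
        Comp_Null[OF i] Hom_Ob[OF h(1)] by simp
    then obtain u where u: "u \<in> Hom A W K" "k \<cdot> u = n \<cdot> h"
      using kernel_factor[OF k(2) g nh] k(1) by (auto simp: Hom_def)
    have "n \<cdot> (k' \<cdot> u) = n \<cdot> h"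
      using Comp_assoc[OF u(1) k'(1) n(1)] k'(2) u(2) by simp
    then have "k' \<cdot> u = h"
      using monic_cancel[OF n(3,1) Comp_Hom[OF u(1) k'(1)] h(1)] by simp
    then show ?thesis
      using u(1) by blast
  qed
  then have "is_kernel A k' t"
    using kernelI[OF k'(1) t(1) k'm tk'] by blast
  then show "K \<in> \<T>"
    using W_LD[OF X NT t(1) k'(1)] by blast
qed

lemma wide_W_L:
  assumes T: "\<T> \<in> tors A"
  shows "wide A (W_L A \<T>)"
proof -
  have WT: "X \<in> \<T>" if "X \<in> W_L A \<T>" for X
    using that W_L_subset by blast
  have "Y \<in> W_L A \<T>" if X: "X \<in> W_L A \<T>" and XY: "iso_objs A X Y" for X Y
  proof -
    have "Y \<in> \<T>"
      using iso_objs_epic[OF XY] tors_epic[OF T] WT[OF X] by blast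
    moreover obtain f where "f \<in> Hom A Y X" "monic A f"
      using iso_objs_sym[OF XY] iso_monic by (auto simp: iso_objs_def)
    ultimately show ?thesis
      using W_L_subobject[OF X] by blast
  qed
  then have "subcategory A (W_L A \<T>)"
    using WT tors_Ob[OF T] by (auto simp: subcategory_def)
  moreover have "W_L A \<T> \<noteq> {}"
    using W_L_zero[OF T] obtain_zero_object by blast
  moreover have "closed_kernels A (W_L A \<T>)"
    unfolding closed_kernels_def
  proof (intro allI impI, elim conjE)
    fix k f
    assume k: "is_kernel A k f" and X: "Dom A f \<in> W_L A \<T>" and Y: "Cod A f \<in> W_L A \<T>"
    have f: "f \<in> Hom A (Dom A f) (Cod A f)" and kH: "k \<in> Hom A (Dom A k) (Dom A f)"
      using k by (auto simp: is_kernel_def Hom_def)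
    show "Dom A k \<in> W_L A \<T>"
      using W_L_subobject[OF X _ kH kernel_monic[OF k]] W_LD[OF Y WT[OF X] f kH k] by blast
  qed
  moreover have "closed_cokernels A (W_L A \<T>)"
    unfolding closed_cokernels_def
  proof (intro allI impI, elim conjE)
    fix c f
    assume c: "is_cokernel A c f" and X: "Dom A f \<in> W_L A \<T>" and Y: "Cod A f \<in> W_L A \<T>"
    have f: "f \<in> Hom A (Dom A f) (Cod A f)" and cH: "c \<in> Hom A (Cod A f) (Cod A c)"
      using c by (auto simp: is_cokernel_def Hom_def)
    show "Cod A c \<in> W_L A \<T>"
      using W_L_cokernel[OF T WT[OF X] Y f cH c] .
  qed
  moreover have "closed_extensions A (W_L A \<T>)"
    unfolding closed_extensions_def
  proof (intro allI impI, elim conjE)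
    fix f g
    assume fg: "short_exact A f g" and X: "Dom A f \<in> W_L A \<T>" and Z: "Cod A g \<in> W_L A \<T>"
    have f: "f \<in> Hom A (Dom A f) (Cod A f)" and g: "g \<in> Hom A (Cod A f) (Cod A g)"
      using fg by (auto simp: short_exact_def is_kernel_def Hom_def)
    show "Cod A f \<in> W_L A \<T>"
      using W_L_extension[OF T X Z f g fg] .
  qed
  ultimately show ?thesis
    by (simp add: wide_def)
qed

section \<open>Wide subcategories and the torsion classes they generate\<close>

lemma wide_kernel:
  assumes "wide A \<W>" "is_kernel A k f" "f \<in> Hom A X Y" "k \<in> Hom A K X" "X \<in> \<W>" "Y \<in> \<W>"
  shows "K \<in> \<W>"
  using assms by (auto simp: wide_def closed_kernels_def Hom_def)

lemma wide_cokernel: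
  assumes "wide A \<W>" "is_cokernel A c f" "f \<in> Hom A X Y" "c \<in> Hom A Y C" "X \<in> \<W>" "Y \<in> \<W>"
  shows "C \<in> \<W>"
  using assms by (auto simp: wide_def closed_cokernels_def Hom_def)

text \<open>
  The objects \<open>Y\<close> of \<open>T(W)\<close> all of whose morphisms to objects of \<open>W\<close> have kernel in \<open>T(W)\<close> and cokernel
  in \<open>W\<close> form a torsion class. The condition on cokernels is what makes the closure under extensions
  work.
\<close>

lemma wide_subset_W_L:
  assumes W: "wide A \<W>"
  shows "\<W> \<subseteq> W_L A (tors_gen A \<W>)"
proof -
  let ?T = "tors_gen A \<W>"
  have WO: "\<W> \<subseteq> Ob A" and W_ne: "\<W> \<noteq> {}"
    using W unfolding wide_def subcategory_def by blast+
  have T: "?T \<in> tors A"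
    using tors_gen_tors[OF WO] .
  define \<S> where "\<S> = {Y \<in> ?T. \<forall>X\<in>\<W>. \<forall>g\<in>Hom A Y X.
    (\<forall>K. \<forall>k\<in>Hom A K Y. is_kernel A k g \<longrightarrow> K \<in> ?T) \<and>
    (\<forall>C. \<forall>c\<in>Hom A X C. is_cokernel A c g \<longrightarrow> C \<in> \<W>)}"
  have S_T: "Y \<in> ?T" if "Y \<in> \<S>" for Y
    using that unfolding \<S>_def mem_Collect_eq by (rule conjunct1)
  have S_D: "(\<forall>K. \<forall>k\<in>Hom A K Y. is_kernel A k g \<longrightarrow> K \<in> ?T) \<and>
      (\<forall>C. \<forall>c\<in>Hom A X C. is_cokernel A c g \<longrightarrow> C \<in> \<W>)"
    if "Y \<in> \<S>" "X \<in> \<W>" "g \<in> Hom A Y X" for X Y g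
    using that(1)[unfolded \<S>_def mem_Collect_eq, THEN conjunct2, THEN bspec, OF that(2),
      THEN bspec, OF that(3)] .
  have S_ker: "K \<in> ?T" if "Y \<in> \<S>" "X \<in> \<W>" "g \<in> Hom A Y X" "k \<in> Hom A K Y" "is_kernel A k g"
    for X Y g K k
    using S_D[OF that(1-3)] that(4,5) by blast
  have S_coker: "C \<in> \<W>" if "Y \<in> \<S>" "X \<in> \<W>" "g \<in> Hom A Y X" "c \<in> Hom A X C" "is_cokernel A c g"
    for X Y g C c
    using S_D[OF that(1-3)] that(4,5) by blast
  have S_I: "Y \<in> \<S>" if "Y \<in> ?T"
    and "\<And>X g K k. X \<in> \<W> \<Longrightarrow> g \<in> Hom A Y X \<Longrightarrow> k \<in> Hom A K Y \<Longrightarrow> is_kernel A k g \<Longrightarrow> K \<in> ?T"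
    and "\<And>X g C c. X \<in> \<W> \<Longrightarrow> g \<in> Hom A Y X \<Longrightarrow> c \<in> Hom A X C \<Longrightarrow> is_cokernel A c g \<Longrightarrow> C \<in> \<W>"
    for Y
    unfolding \<S>_def by (intro CollectI conjI ballI allI impI) (fact that)+
  have WS: "\<W> \<subseteq> \<S>"
  proof
    fix Y
    assume Y: "Y \<in> \<W>"
    show "Y \<in> \<S>"
    proof (rule S_I)
      show "Y \<in> ?T"
        using Y tors_gen_subset by blast
    next
      fix X g K k
      assume "X \<in> \<W>" "g \<in> Hom A Y X" "k \<in> Hom A K Y" "is_kernel A k g"
      then show "K \<in> ?T"
        using wide_kernel[OF W] Y tors_gen_subset by blast
    next
      fix X g C c
      assume "X \<in> \<W>" "g \<in> Hom A Y X" "c \<in> Hom A X C" "is_cokernel A c g"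
      then show "C \<in> \<W>"
        using wide_cokernel[OF W] Y by blast
    qed
  qed
  have "\<S> \<in> tors A"
  proof (rule torsI)
    show "\<S> \<subseteq> Ob A"
      using S_T tors_Ob[OF T] by blast
    show "\<S> \<noteq> {}"
      using WS W_ne by blast
  next
    fix e Y Z
    assume e: "e \<in> Hom A Y Z" "epic A e" and Y: "Y \<in> \<S>"
    show "Z \<in> \<S>"
    proof (rule S_I)
      show "Z \<in> ?T"
        using tors_epic[OF T e] S_T[OF Y] by blast
    next
      fix X g K k
      assume X: "X \<in> \<W>" and g: "g \<in> Hom A Z X" and k: "k \<in> Hom A K Z" "is_kernel A k g"
      have ge: "g \<cdot> e \<in> Hom A Y X"
        using Comp_Hom[OF e(1) g] .
      have km: "monic A k"
        using kernel_monic[OF k(2)] .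
      have gk: "g \<cdot> k = Null A K X"
        using kernel_Null[OF k(2) g] k(1) by (simp add: Hom_def)
      obtain L l where l: "l \<in> Hom A L Y" "is_kernel A l (g \<cdot> e)" "monic A l" "g \<cdot> e \<cdot> l = Null A L X"
        using obtain_kernel[OF ge] .
      have el: "e \<cdot> l \<in> Hom A L Z"
        using Comp_Hom[OF l(1) e(1)] .
      have "g \<cdot> (e \<cdot> l) = Null A L X"
        using l(4) Comp_assoc[OF l(1) e(1) g] by simp
      then obtain t where t: "t \<in> Hom A L K" "k \<cdot> t = e \<cdot> l"
        using kernel_factor[OF k(2) g el] k(1) by (auto simp: Hom_def)
      \<comment> \<open>Generalized elements of K lift to Y along e on a cover, and the lifts lie in
        L. So L -> K is epic and K is a factor of L.\<close>
      obtain V w y where w: "w \<in> Hom A V K" "epic A w" and y: "y \<in> Hom A V Y" "e \<cdot> y = k \<cdot> w"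
        using epic_lift[OF e k(1)] .
      have "(g \<cdot> e) \<cdot> y = Null A V X"
        using Comp_assoc[OF y(1) e(1) g] y(2) Comp_assoc[OF w(1) k(1) g] gk Null_Comp[OF w(1)]
          Hom_Ob[OF g] by simp
      then obtain s where s: "s \<in> Hom A V L" "l \<cdot> s = y"
        using kernel_factor[OF l(2) ge y(1)] l(1) by (auto simp: Hom_def)
      have "k \<cdot> (t \<cdot> s) = k \<cdot> w"
        using Comp_assoc[OF s(1) t(1) k(1)] t(2) Comp_assoc[OF s(1) l(1) e(1)] s(2) y(2) by simp
      then have "t \<cdot> s = w"
        using monic_cancel[OF km k(1) Comp_Hom[OF s(1) t(1)] w(1)] by simp
      then have "epic A t"
        using epicI_lift[OF t(1) w s(1)] by simp
      moreover have "L \<in> ?T"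
        using S_ker[OF Y X ge l(1,2)] .
      ultimately show "K \<in> ?T"
        using tors_epic[OF T t(1)] by blast
    next
      fix X g C c
      assume X: "X \<in> \<W>" and g: "g \<in> Hom A Z X" and c: "c \<in> Hom A X C" "is_cokernel A c g"
      have ge: "g \<cdot> e \<in> Hom A Y X"
        using Comp_Hom[OF e(1) g] .
      have OX: "C \<in> Ob A"
        using Hom_Ob[OF c(1)] by simp
      have "c \<cdot> g = Null A Z C"
        using cokernel_Null[OF c(2) g] c(1) by (simp add: Hom_def)
      then have cge: "c \<cdot> (g \<cdot> e) = Null A Y C"
        using Comp_assoc[OF e(1) g c(1)] Null_Comp[OF e(1) OX] by simp
      \<comment> \<open>As e is epic, g and g e have the same cokernel.\<close>
      have "\<exists>u\<in>Hom A C V. u \<cdot> c = h" if h: "h \<in> Hom A X V" "h \<cdot> (g \<cdot> e) = Null A Y V" for V h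
      proof -
        have "(h \<cdot> g) \<cdot> e = Null A Y V"
          using h(2) Comp_assoc[OF e(1) g h(1)] by simp
        then have "h \<cdot> g = Null A Z V"
          using epic_Null[OF e(2,1) Comp_Hom[OF g h(1)]] by simp
        then show ?thesis
          using cokernel_factor[OF c(2) g h(1)] c(1) by (auto simp: Hom_def)
      qed
      then have "is_cokernel A c (g \<cdot> e)"
        using cokernelI[OF c(1) ge cokernel_epic[OF c(2)] cge] by blast
      then show "C \<in> \<W>"
        using S_coker[OF Y X ge c(1)] by blast
    qed
  next
    fix i q Y1 Y Y2
    assume i: "i \<in> Hom A Y1 Y" and q: "q \<in> Hom A Y Y2" and iq: "short_exact A i q"
      and Y1: "Y1 \<in> \<S>" and Y2: "Y2 \<in> \<S>"
    note iqD = short_exactD[OF iq i q]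
    \<comment> \<open>The cokernel C1 of g restricted to Y1 lies in W because Y1 is in
      \<open>\<S>\<close>; therefore the condition on Y2 applies to the morphism g2 that g induces
      from Y2 to C1.\<close>
    have quot: "\<exists>C1 c1 g2. c1 \<in> Hom A X C1 \<and> is_cokernel A c1 (g \<cdot> i) \<and> epic A c1 \<and>
        g2 \<in> Hom A Y2 C1 \<and> g2 \<cdot> q = c1 \<cdot> g \<and> C1 \<in> \<W>"
      if X: "X \<in> \<W>" and g: "g \<in> Hom A Y X" for X g
    proof -
      have gi: "g \<cdot> i \<in> Hom A Y1 X"
        using Comp_Hom[OF i g] .
      obtain C1 c1 where c1: "c1 \<in> Hom A X C1" "is_cokernel A c1 (g \<cdot> i)" "epic A c1"
          "c1 \<cdot> (g \<cdot> i) = Null A Y1 C1"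
        using obtain_cokernel[OF gi] .
      have "(c1 \<cdot> g) \<cdot> i = Null A Y1 C1"
        using c1(4) Comp_assoc[OF i g c1(1)] by simp
      then obtain g2 where "g2 \<in> Hom A Y2 C1" "g2 \<cdot> q = c1 \<cdot> g"
        using short_exact_cofactor[OF iq i q Comp_Hom[OF g c1(1)]] by blast
      then show ?thesis
        using c1 S_coker[OF Y1 X gi c1(1,2)] by blast
    qed
    show "Y \<in> \<S>"
    proof (rule S_I)
      show "Y \<in> ?T"
        using tors_extension[OF T iq i q] S_T Y1 Y2 by blast
    next
      fix X g C c
      assume X: "X \<in> \<W>" and g: "g \<in> Hom A Y X" and c: "c \<in> Hom A X C" "is_cokernel A c g"
      obtain C1 c1 g2 where c1: "c1 \<in> Hom A X C1" "is_cokernel A c1 (g \<cdot> i)" "epic A c1"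
        and g2: "g2 \<in> Hom A Y2 C1" "g2 \<cdot> q = c1 \<cdot> g" and C1: "C1 \<in> \<W>"
        using quot[OF X g] by blast
      have OC: "C \<in> Ob A"
        using Hom_Ob[OF c(1)] by simp
      have gi: "g \<cdot> i \<in> Hom A Y1 X"
        using Comp_Hom[OF i g] .
      have cg: "c \<cdot> g = Null A Y C"
        using cokernel_Null[OF c(2) g] c(1) by (simp add: Hom_def)
      then have "c \<cdot> (g \<cdot> i) = Null A Y1 C"
        using Comp_assoc[OF i g c(1)] Null_Comp[OF i OC] by simp
      then obtain c' where c': "c' \<in> Hom A C1 C" "c' \<cdot> c1 = c"
        using cokernel_factor[OF c1(2) gi c(1)] c1(1) by (auto simp: Hom_def)
      have c'e: "epic A c'"
        using epic_Comp_left[OF _ c1(1) c'(1)] c'(2) cokernel_epic[OF c(2)] by simp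
      have "(c' \<cdot> g2) \<cdot> q = Null A Y C"
        using Comp_assoc[OF q g2(1) c'(1)] g2(2) Comp_assoc[OF g c1(1) c'(1)] c'(2) cg by simp
      then have c'g2: "c' \<cdot> g2 = Null A Y2 C"
        using epic_Null[OF iqD(2) q Comp_Hom[OF g2(1) c'(1)]] by simp
      \<comment> \<open>The cokernel of g2 is c': a morphism on C1 that kills g2 becomes, on X, one
        that kills g, and so factors through c.\<close>
      have "\<exists>u\<in>Hom A C V. u \<cdot> c' = h" if h: "h \<in> Hom A C1 V" "h \<cdot> g2 = Null A Y2 V" for V h
      proof -
        have hc1: "h \<cdot> c1 \<in> Hom A X V"
          using Comp_Hom[OF c1(1) h(1)] .
        have "(h \<cdot> c1) \<cdot> g = Null A Y V"
          using Comp_assoc[OF g c1(1) h(1)] g2(2)[symmetric] Comp_assoc[OF q g2(1) h(1)] h(2)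
            Null_Comp[OF q] Hom_Ob[OF h(1)] by simp
        then obtain u where u: "u \<in> Hom A C V" "u \<cdot> c = h \<cdot> c1"
          using cokernel_factor[OF c(2) g hc1] c(1) by (auto simp: Hom_def)
        have "(u \<cdot> c') \<cdot> c1 = h \<cdot> c1"
          using Comp_assoc[OF c1(1) c'(1) u(1)] c'(2) u(2) by simp
        then have "u \<cdot> c' = h"
          using epic_cancel[OF c1(3,1) Comp_Hom[OF c'(1) u(1)] h(1)] by simp
        then show ?thesis
          using u(1) by blast
      qed
      then have "is_cokernel A c' g2"
        using cokernelI[OF c'(1) g2(1) c'e c'g2] by blast
      then show "C \<in> \<W>"
        using S_coker[OF Y2 C1 g2(1) c'(1)] by blast
    next
      fix X g K k
      assume X: "X \<in> \<W>" and g: "g \<in> Hom A Y X" and k: "k \<in> Hom A K Y" "is_kernel A k g"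
      obtain C1 c1 g2 where c1: "c1 \<in> Hom A X C1" "is_cokernel A c1 (g \<cdot> i)" "epic A c1"
        and g2: "g2 \<in> Hom A Y2 C1" "g2 \<cdot> q = c1 \<cdot> g" and C1: "C1 \<in> \<W>"
        using quot[OF X g] by blast
      have O: "X \<in> Ob A" "C1 \<in> Ob A" "K \<in> Ob A" "Y2 \<in> Ob A"
        using Hom_Ob[OF c1(1)] Hom_Ob[OF k(1)] Hom_Ob[OF g2(1)] by auto
      have gi: "g \<cdot> i \<in> Hom A Y1 X"
        using Comp_Hom[OF i g] .
      have km: "monic A k"
        using kernel_monic[OF k(2)] .
      have gk: "g \<cdot> k = Null A K X"
        using kernel_Null[OF k(2) g] k(1) by (simp add: Hom_def)
      obtain K1 l1 where l1: "l1 \<in> Hom A K1 Y1" "is_kernel A l1 (g \<cdot> i)" "monic A l1"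
          "g \<cdot> i \<cdot> l1 = Null A K1 X"
        using obtain_kernel[OF gi] .
      obtain K2 k2 where k2: "k2 \<in> Hom A K2 Y2" "is_kernel A k2 g2" "monic A k2"
          "g2 \<cdot> k2 = Null A K2 C1"
        using obtain_kernel[OF g2(1)] .
      have il1: "i \<cdot> l1 \<in> Hom A K1 Y"
        using Comp_Hom[OF l1(1) i] .
      have qk: "q \<cdot> k \<in> Hom A K Y2"
        using Comp_Hom[OF k(1) q] .
      have "g \<cdot> (i \<cdot> l1) = Null A K1 X"
        using l1(4) Comp_assoc[OF l1(1) i g] by simp
      then obtain a where a: "a \<in> Hom A K1 K" "k \<cdot> a = i \<cdot> l1"
        using kernel_factor[OF k(2) g il1] k(1) by (auto simp: Hom_def)
      have "g2 \<cdot> (q \<cdot> k) = Null A K C1"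
        using Comp_assoc[OF k(1) q g2(1)] g2(2) Comp_assoc[OF k(1) g c1(1)] gk Comp_Null[OF c1(1) O(3)]
        by simp
      then obtain b where b: "b \<in> Hom A K K2" "k2 \<cdot> b = q \<cdot> k"
        using kernel_factor[OF k2(2) g2(1) qk] k2(1) by (auto simp: Hom_def)
      have am: "monic A a"
        using monic_Comp_right[OF _ a(1) k(1)] a(2) monic_Comp[OF l1(3,1) iqD(1) i] by simp
      have "k2 \<cdot> (b \<cdot> a) = Null A K1 Y2"
        using Comp_assoc[OF a(1) b(1) k2(1)] b(2) Comp_assoc[OF a(1) k(1) q] a(2)
          Comp_assoc[OF l1(1) i q] iqD(3) Null_Comp[OF l1(1) O(4)] by simp
      then have ba: "b \<cdot> a = Null A K1 K2"
        using monic_Null[OF k2(3,1) Comp_Hom[OF a(1) b(1)]] by simp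
      \<comment> \<open>Part of the snake lemma, which with \<open>be\<close> below makes K an
        extension of K2 by K1: generalized elements of K killed by b come from Y1 and there lie in
        K1.\<close>
      have factor: "\<exists>u\<in>Hom A W K1. a \<cdot> u = h" if h: "h \<in> Hom A W K" "b \<cdot> h = Null A W K2" for W h
      proof -
        have OW: "W \<in> Ob A"
          using Hom_Ob[OF h(1)] by simp
        have kh: "k \<cdot> h \<in> Hom A W Y"
          using Comp_Hom[OF h(1) k(1)] .
        have "q \<cdot> (k \<cdot> h) = Null A W Y2"
          using Comp_assoc[OF h(1) k(1) q] b(2)[symmetric] Comp_assoc[OF h(1) b(1) k2(1)] h(2)
            Comp_Null[OF k2(1) OW] by simp
        then obtain u where u: "u \<in> Hom A W Y1" "i \<cdot> u = k \<cdot> h"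
          using short_exact_factor[OF iq i q kh] by blast
        have "(g \<cdot> i) \<cdot> u = Null A W X"
          using Comp_assoc[OF u(1) i g] u(2) Comp_assoc[OF h(1) k(1) g] gk Null_Comp[OF h(1) O(1)]
          by simp
        then obtain v where v: "v \<in> Hom A W K1" "l1 \<cdot> v = u"
          using kernel_factor[OF l1(2) gi u(1)] l1(1) by (auto simp: Hom_def)
        have "k \<cdot> (a \<cdot> v) = k \<cdot> h"
          using Comp_assoc[OF v(1) a(1) k(1)] a(2) Comp_assoc[OF v(1) l1(1) i] v(2) u(2) by simp
        then have "a \<cdot> v = h"
          using monic_cancel[OF km k(1) Comp_Hom[OF v(1) a(1)] h(1)] by simp
        then show ?thesis
          using v(1) by blast
      qed
      \<comment> \<open>For b to be epic, lift a cover of K2 to y in Y. The value g y need not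
        vanish, but it dies in C1, so on a further cover it comes from some y1 in Y1.\<close>
      obtain V w y where w: "w \<in> Hom A V K2" "epic A w" and y: "y \<in> Hom A V Y" "q \<cdot> y = k2 \<cdot> w"
        using epic_lift[OF q iqD(2) k2(1)] .
      have gy: "g \<cdot> y \<in> Hom A V X"
        using Comp_Hom[OF y(1) g] .
      have "c1 \<cdot> (g \<cdot> y) = Null A V C1"
        using Comp_assoc[OF y(1) g c1(1)] g2(2)[symmetric] Comp_assoc[OF y(1) q g2(1)] y(2)
          Comp_assoc[OF w(1) k2(1) g2(1)] k2(4) Null_Comp[OF w(1) O(2)] by simp
      then obtain V' w' y1 where w': "w' \<in> Hom A V' V" "epic A w'" and y1: "y1 \<in> Hom A V' Y1"
        and giy1: "(g \<cdot> i) \<cdot> y1 = (g \<cdot> y) \<cdot> w'"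
        using exact_lift[OF gi c1(1,2) gy] by blast
      have yw': "y \<cdot> w' \<in> Hom A V' Y" and iy1: "i \<cdot> y1 \<in> Hom A V' Y"
        using Comp_Hom[OF w'(1) y(1)] Comp_Hom[OF y1 i] by auto
      \<comment> \<open>Correcting y by y1 gives a d that g kills and that has the same image in Y2
        as y.\<close>
      obtain d where d: "d \<in> Hom A V' Y" "y \<cdot> w' = Plus A d (i \<cdot> y1)"
        using ex_diff[OF yw' iy1] .
      have "Plus A (g \<cdot> d) (g \<cdot> (i \<cdot> y1)) = g \<cdot> (y \<cdot> w')"
        unfolding d(2) Comp_Plus[OF d(1) iy1 g] ..
      also have "\<dots> = g \<cdot> (i \<cdot> y1)"
        using giy1 unfolding Comp_assoc[OF w'(1) y(1) g] Comp_assoc[OF y1 i g] by simp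
      finally have "g \<cdot> d = Null A V' X"
        using Plus_eq_right[OF Comp_Hom[OF d(1) g] Comp_Hom[OF iy1 g]] by simp
      then obtain s where s: "s \<in> Hom A V' K" "k \<cdot> s = d"
        using kernel_factor[OF k(2) g d(1)] k(1) by (auto simp: Hom_def)
      have OV': "V' \<in> Ob A"
        using Hom_Ob[OF w'(1)] by simp
      have qiy1: "q \<cdot> (i \<cdot> y1) = Null A V' Y2"
        using Comp_assoc[OF y1 i q] iqD(3) Null_Comp[OF y1 O(4)] by simp
      have "q \<cdot> (y \<cdot> w') = q \<cdot> d"
        unfolding d(2) Comp_Plus[OF d(1) iy1 q] qiy1 Plus_Null[OF Comp_Hom[OF d(1) q]] ..
      then have "k2 \<cdot> (b \<cdot> s) = k2 \<cdot> (w \<cdot> w')"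
        using Comp_assoc[OF s(1) b(1) k2(1)] b(2) Comp_assoc[OF s(1) k(1) q] s(2)
          Comp_assoc[OF w'(1) y(1) q] y(2) Comp_assoc[OF w'(1) w(1) k2(1)] by simp
      then have "b \<cdot> s = w \<cdot> w'"
        using monic_cancel[OF k2(3,1) Comp_Hom[OF s(1) b(1)] Comp_Hom[OF w'(1) w(1)]] by simp
      then have be: "epic A b"
        using epicI_lift[OF b(1) Comp_Hom[OF w'(1) w(1)] epic_Comp[OF w'(2,1) w(2,1)] s(1)] by simp
      have "short_exact A a b"
        using short_exactI[OF a(1) am b(1) be ba] factor by blast
      moreover have "K1 \<in> ?T"
        using S_ker[OF Y1 X gi l1(1,2)] .
      moreover have "K2 \<in> ?T"
        using S_ker[OF Y2 C1 g2(1) k2(1,2)] .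
      ultimately show "K \<in> ?T"
        using tors_extension[OF T _ a(1) b(1)] by blast
    qed
  qed
  then have TS: "?T \<subseteq> \<S>"
    using tors_gen_minimal WS by blast
  show ?thesis
  proof
    fix X
    assume X: "X \<in> \<W>"
    show "X \<in> W_L A ?T"
    proof (rule W_LI)
      show "X \<in> ?T"
        using X tors_gen_subset by blast
    next
      fix Y g K k
      assume "Y \<in> ?T" "g \<in> Hom A Y X" "k \<in> Hom A K Y" "is_kernel A k g"
      then show "K \<in> ?T"
        using S_ker[OF _ X] TS by blast
    qed
  qed
qed

lemma widely_generated_iff:
  assumes T: "\<T> \<in> tors A"
  shows "widely_generated A \<T> \<longleftrightarrow> \<T> = tors_gen A (W_L A \<T>)"
proof
  assume "widely_generated A \<T>"
  then obtain \<W> where "wide A \<W>" "\<T> = tors_gen A \<W>"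
    by (auto simp: widely_generated_def)
  then have "\<T> \<subseteq> tors_gen A (W_L A \<T>)"
    using wide_subset_W_L tors_gen_mono by metis
  then show "\<T> = tors_gen A (W_L A \<T>)"
    using tors_gen_minimal[OF T W_L_subset] by blast
next
  assume "\<T> = tors_gen A (W_L A \<T>)"
  then show "widely_generated A \<T>"
    using wide_W_L[OF T] by (auto simp: widely_generated_def)
qed

end

section \<open>Hasse arrows\<close>

context abelian_length_category
begin

definition tors_simple :: "'a set \<Rightarrow> 'a \<Rightarrow> bool" where
  "tors_simple \<T> S \<longleftrightarrow> S \<in> \<T> \<and> \<not> zero_object A S \<and>
    (\<forall>X\<in>\<T>. \<forall>f\<in>Hom A X S. f = Null A X S \<or> epic A f)"

lemma tors_simple_epic:
  assumes "tors_simple \<T> S" "X \<in> \<T>" "f \<in> Hom A X S" "f \<noteq> Null A X S"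
  shows "epic A f"
  using assms unfolding tors_simple_def by blast

lemma tors_simple_not_no_maps_to:
  assumes "tors_simple \<T> S" "S \<in> Ob A"
  shows "S \<notin> no_maps_to \<T> S"
  using no_maps_toD[OF _ Id_Hom] assms by (auto simp: tors_simple_def zero_object_iff)

text \<open>
  Minimality of the length together with the closure of \<open>\<U>\<close> under extensions forces the image of a
  nonzero morphism to be everything.
\<close>

lemma tors_simple_if_minimal:
  assumes U: "\<U> \<in> tors A" and S: "S \<in> \<T>" "S \<in> Ob A" "S \<notin> \<U>"
    and quotients: "\<And>X I e m C c. X \<in> \<T> \<Longrightarrow> e \<in> Hom A X I \<Longrightarrow> epic A e \<Longrightarrow> m \<in> Hom A I S \<Longrightarrow> monic A m
      \<Longrightarrow> c \<in> Hom A S C \<Longrightarrow> is_cokernel A c m \<Longrightarrow>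
      (obj_length I < obj_length S \<longrightarrow> I \<in> \<U>) \<and> (obj_length C < obj_length S \<longrightarrow> C \<in> \<U>)"
  shows "tors_simple \<T> S"
proof -
  have "f = Null A X S \<or> epic A f" if X: "X \<in> \<T>" and f: "f \<in> Hom A X S" for X f
  proof (rule disjCI)
    assume nepi: "\<not> epic A f"
    obtain I e m where e: "e \<in> Hom A X I" "epic A e" and m: "m \<in> Hom A I S" "monic A m"
      and fme: "f = m \<cdot> e"
      using image_factorization[OF f] .
    obtain C c where c: "c \<in> Hom A S C" "is_cokernel A c m" "epic A c"
      using obtain_cokernel[OF m(1)] .
    have mc: "short_exact A m c"
      using cokernel_of_monic_short_exact[OF m c(2)] .
    have "\<not> is_iso A m"
      using nepi fme epic_Comp[OF e(2,1) _ m(1)] iso_epic[OF _ m(1)] by blast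
    then have "obj_length I < obj_length S"
      using monic_iso_or_shorter[OF m] by blast
    then have IU: "I \<in> \<U>"
      using quotients[OF X e m c(1,2)] by blast
    show "f = Null A X S"
    proof (rule ccontr)
      assume f0: "f \<noteq> Null A X S"
      \<comment> \<open>A nonzero image makes the cokernel shorter as well, so both ends of an
        extension with middle term S would lie in \<open>\<U>\<close>.\<close>
      have "\<not> zero_object A I"
      proof
        assume "zero_object A I"
        then have "e = Null A X I"
          using Hom_zero_right e(1) by blast
        then show False
          using f0 fme Comp_Null[OF m(1)] Hom_Ob[OF f] by simp
      qed
      then have "obj_length C < obj_length S"
        using obj_length_short_exact[OF mc m(1) c(1)] obj_length_pos[of I] Hom_Ob[OF m(1)] by simp
      then have "C \<in> \<U>"
        using quotients[OF X e m c(1,2)] by blast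
      then show False
        using tors_extension[OF U mc m(1) c(1) IU] S(3) by blast
    qed
  qed
  moreover have "\<not> zero_object A S"
    using tors_zero[OF U] S(3) by blast
  ultimately show ?thesis
    using S(1) unfolding tors_simple_def by blast
qed

text \<open>A nonzero morphism from an object of \<open>\<U>\<close> to S would be epic and make S a
  factor of that object.\<close>

lemma subset_no_maps_to:
  assumes S: "tors_simple \<T> S" and U: "\<U> \<in> tors A" "\<U> \<subseteq> \<T>" "S \<notin> \<U>"
  shows "\<U> \<subseteq> no_maps_to \<T> S"
proof
  fix X
  assume X: "X \<in> \<U>"
  show "X \<in> no_maps_to \<T> S"
  proof (rule no_maps_toI)
    show "X \<in> \<T>"
      using X U(2) by blast
    fix f
    assume f: "f \<in> Hom A X S"
    show "f = Null A X S"
    proof (rule ccontr)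
      assume "f \<noteq> Null A X S"
      then have "epic A f"
        using tors_simple_epic[OF S _ f] X U(2) by blast
      then show False
        using tors_epic[OF U(1) f] X U(3) by blast
    qed
  qed
qed

text \<open>A torsion class V in T strictly above \<open>no_maps_to \<T> S\<close> contains S. Any Y
  in T with a nonzero morphism to S is then an extension of S by the kernel of that morphism. The
  kernel is shorter than Y and in T because S is in W_L(T), so induction on the length puts Y into
  V.\<close>

lemma hasse_arrow_no_maps_to:
  assumes T: "\<T> \<in> tors A" and S: "tors_simple \<T> S" and SW: "S \<in> W_L A \<T>"
  shows "hasse_arrow A \<T> (no_maps_to \<T> S)"
proof -
  have ST: "S \<in> \<T>" and SO: "S \<in> Ob A" and S0: "\<not> zero_object A S"
    using S tors_Ob[OF T] by (auto simp: tors_simple_def)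
  have "V = \<T>" if V: "V \<in> tors A" "no_maps_to \<T> S \<subset> V" "V \<subseteq> \<T>" for V
  proof -
    have SV: "S \<in> V"
      using subset_no_maps_to[OF S V(1,3)] V(2) by blast
    have "Y \<in> V" if "Y \<in> \<T>" for Y
      using that
    proof (induction "obj_length Y" arbitrary: Y rule: less_induct)
      case less
      show ?case
      proof (cases "Y \<in> no_maps_to \<T> S")
        case True
        then show ?thesis
          using V(2) by blast
      next
        case False
        then obtain g where g: "g \<in> Hom A Y S" "g \<noteq> Null A Y S"
          using no_maps_toI[OF less.prems] by blast
        have ge: "epic A g"
          using tors_simple_epic[OF S less.prems g] .
        obtain K k where k: "k \<in> Hom A K Y" "is_kernel A k g"
          using obtain_kernel[OF g(1)] .
        have "K \<in> \<T>"
          using W_LD[OF SW less.prems g(1) k] .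
        moreover have "obj_length K < obj_length Y"
          using obj_length_short_exact[OF kernel_of_epic_short_exact[OF g(1) ge k(2)] k(1) g(1)]
            obj_length_pos[OF SO S0] by simp
        ultimately show ?thesis
          using tors_epic_extension[OF V(1) g(1) ge k _ SV] less.hyps by blast
      qed
    qed
    then show ?thesis
      using V(3) by blast
  qed
  moreover have "no_maps_to \<T> S \<subset> \<T>"
    using no_maps_to_subset ST tors_simple_not_no_maps_to[OF S SO] by blast
  ultimately show ?thesis
    unfolding hasse_arrow_def using T no_maps_to_tors[OF T SO] by blast
qed

text \<open>The object S has minimal length in W_L(T) outside \<open>\<U>\<close>, rather than in T
  outside \<open>\<U>\<close>: its membership in W_L(T) is what yields a cover. As W_L(T) contains
  the images and cokernels in question, minimality still makes S simple relative to T.\<close>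

lemma ex_hasse_arrow_above:
  assumes T: "\<T> \<in> tors A" and U: "\<U> \<in> tors A" "\<U> \<subseteq> \<T>" and W: "\<not> W_L A \<T> \<subseteq> \<U>"
  shows "\<exists>\<U>'. hasse_arrow A \<T> \<U>' \<and> \<U> \<subseteq> \<U>'"
proof -
  obtain S where S: "S \<in> W_L A \<T>" "S \<notin> \<U>"
    and min: "\<And>X. X \<in> W_L A \<T> \<Longrightarrow> obj_length X < obj_length S \<Longrightarrow> X \<in> \<U>"
    using W ex_has_least_nat[of "\<lambda>X. X \<in> W_L A \<T> \<and> X \<notin> \<U>" _ obj_length]
    by (metis not_le subsetI)
  have ST: "S \<in> \<T>"
    using S W_L_subset by blast
  have simple: "tors_simple \<T> S"
  proof (rule tors_simple_if_minimal[OF U(1) ST tors_Ob[OF T ST] S(2)])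
    fix X I e m C c
    assume X: "X \<in> \<T>" and e: "e \<in> Hom A X I" "epic A e" and m: "m \<in> Hom A I S" "monic A m"
      and c: "c \<in> Hom A S C" "is_cokernel A c m"
    have IT: "I \<in> \<T>"
      using tors_epic[OF T e X] .
    have "I \<in> W_L A \<T>" "C \<in> W_L A \<T>"
      using W_L_subobject[OF S(1) IT m] W_L_cokernel[OF T IT S(1) m(1) c] by auto
    then show "(obj_length I < obj_length S \<longrightarrow> I \<in> \<U>) \<and> (obj_length C < obj_length S \<longrightarrow> C \<in> \<U>)"
      using min by blast
  qed
  show ?thesis
    using hasse_arrow_no_maps_to[OF T simple S(1)] subset_no_maps_to[OF simple U S(2)] by blast
qed

text \<open>S has minimal length in T outside \<open>\<U>\<close>. The class of objects of T without
  nonzero morphism to S contains \<open>\<U>\<close> and misses S, so the covering relation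
  identifies it with \<open>\<U>\<close>.\<close>

lemma hasse_arrow_tors_simple:
  assumes H: "hasse_arrow A \<T> \<U>"
  obtains S where "tors_simple \<T> S" "S \<notin> \<U>" "\<U> = no_maps_to \<T> S"
proof -
  have T: "\<T> \<in> tors A" and U: "\<U> \<in> tors A" and UT: "\<U> \<subset> \<T>"
    and cover: "\<And>V. V \<in> tors A \<Longrightarrow> \<U> \<subseteq> V \<Longrightarrow> V \<subset> \<T> \<Longrightarrow> V = \<U>"
    using H unfolding hasse_arrow_def by blast+
  obtain S where S: "S \<in> \<T>" "S \<notin> \<U>"
    and min: "\<And>X. X \<in> \<T> \<Longrightarrow> obj_length X < obj_length S \<Longrightarrow> X \<in> \<U>"
    using UT ex_has_least_nat[of "\<lambda>X. X \<in> \<T> \<and> X \<notin> \<U>" _ obj_length]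
    by (metis not_le psubset_imp_ex_mem Diff_iff)
  have SO: "S \<in> Ob A"
    using tors_Ob[OF T S(1)] .
  have simple: "tors_simple \<T> S"
  proof (rule tors_simple_if_minimal[OF U S(1) SO S(2)])
    fix X I e m C c
    assume X: "X \<in> \<T>" and e: "e \<in> Hom A X I" "epic A e" and m: "m \<in> Hom A I S" "monic A m"
      and c: "c \<in> Hom A S C" "is_cokernel A c m"
    have "I \<in> \<T>" "C \<in> \<T>"
      using tors_epic[OF T e X] tors_epic[OF T c(1) cokernel_epic[OF c(2)] S(1)] by auto
    then show "(obj_length I < obj_length S \<longrightarrow> I \<in> \<U>) \<and> (obj_length C < obj_length S \<longrightarrow> C \<in> \<U>)"
      using min by blast
  qed
  have "no_maps_to \<T> S \<subset> \<T>"
    using no_maps_to_subset S(1) tors_simple_not_no_maps_to[OF simple SO] by blast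
  then have "no_maps_to \<T> S = \<U>"
    using cover[OF no_maps_to_tors[OF T SO] subset_no_maps_to[OF simple U _ S(2)]] UT by blast
  then show ?thesis
    using that[OF simple S(2)] by blast
qed

section \<open>Bricks and the labels of Hasse arrows\<close>

lemma endo_epic_iso:
  assumes "f \<in> Hom A X X" "epic A f"
  shows "is_iso A f"
  using epic_iso_or_shorter[OF assms] by simp

text \<open>Schur's lemma: a nonzero endomorphism is epic, and an epic endomorphism is iso because
  the length cannot drop.\<close>

lemma tors_simple_brick:
  assumes S: "tors_simple \<T> S" and SO: "S \<in> Ob A"
  shows "brick A S"
proof -
  let ?R = "End_ring A S"
  note Id = Id_Hom[OF SO]
  have "comm_group (add_monoid ?R)"
    using Hom_comm_group[OF SO SO]
    by (auto simp: comm_group_def comm_monoid_def comm_monoid_axioms_def group_def group_axioms_def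
        monoid_def Units_def End_ring_def Hom_group_def)
  moreover have "monoid ?R"
    by (rule monoidI) (auto simp: End_ring_def Id Comp_Hom Comp_Id Id_Comp Comp_assoc)
  ultimately have "ring ?R"
    using Comp_Plus Plus_Comp
    by (auto simp: ring_def ring_axioms_def abelian_group_def abelian_group_axioms_def
        abelian_monoid_def comm_group_def End_ring_def)
  moreover have "Id A S \<noteq> Null A S S"
    using S SO by (auto simp: tors_simple_def zero_object_iff)
  moreover have "f \<in> Units ?R" if f: "f \<in> Hom A S S" "f \<noteq> Null A S S" for f
  proof -
    have "epic A f"
      using tors_simple_epic[OF S _ f] S by (simp add: tors_simple_def)
    then obtain g where "g \<in> Hom A S S" "g \<cdot> f = Id A S" "f \<cdot> g = Id A S"
      using isoE[OF endo_epic_iso[OF f(1)] f(1)] by blast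
    then show ?thesis
      using f(1) by (auto simp: Units_def End_ring_def)
  qed
  ultimately have "division_ring ?R"
    by (auto simp: division_ring_def division_ring_axioms_def End_ring_def)
  then show ?thesis
    using SO by (simp add: brick_def)
qed

lemma brick_not_zero:
  assumes "brick A B"
  shows "\<not> zero_object A B"
  using assms division_ring.one_not_zero[of "End_ring A B"]
  by (auto simp: brick_def End_ring_def zero_object_iff)

lemma brick_endo_iso:
  assumes B: "brick A B" and f: "f \<in> Hom A B B" "f \<noteq> Null A B B"
  shows "is_iso A f"
proof -
  have "f \<in> Units (End_ring A B)"
    using B f division_ring.nonzero_Units[of "End_ring A B"] by (auto simp: brick_def End_ring_def)
  then obtain g where "g \<in> Hom A B B" "g \<cdot> f = Id A B" "f \<cdot> g = Id A B"
    by (auto simp: Units_def End_ring_def)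
  then show ?thesis
    using isoI f(1) by blast
qed

text \<open>Beyond \<open>hasse_arrow_tors_simple\<close>, the covering relation yields membership
  of S in W_L(T) and uniqueness of the brick. Both rest on \<open>nonzero_from_S\<close>, once for
  the source Y of an epimorphism onto S and once for a competing brick.\<close>

lemma hasse_arrow_label:
  assumes H: "hasse_arrow A \<T> \<U>"
  obtains S where "tors_simple \<T> S" "S \<in> W_L A \<T>" "S \<notin> \<U>" "\<U> = no_maps_to \<T> S"
    "is_brick_label A \<T> \<U> S"
proof -
  obtain S where S: "tors_simple \<T> S" and SU: "S \<notin> \<U>" and Ueq: "\<U> = no_maps_to \<T> S"
    using hasse_arrow_tors_simple[OF H] .
  have T: "\<T> \<in> tors A" and U: "\<U> \<in> tors A" and UT: "\<U> \<subset> \<T>"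
    and cover: "\<And>V. V \<in> tors A \<Longrightarrow> \<U> \<subseteq> V \<Longrightarrow> V \<subset> \<T> \<Longrightarrow> V = \<U>"
    using H unfolding hasse_arrow_def by blast+
  have ST: "S \<in> \<T>"
    using S by (simp add: tors_simple_def)
  have SO: "S \<in> Ob A"
    using tors_Ob[OF T ST] .
  text \<open>
    The objects of \<open>\<T>\<close> without nonzero morphisms to such a \<open>Y\<close> form a torsion class between \<open>\<U>\<close> and
    \<open>\<T>\<close>, which is therefore \<open>\<U>\<close>, and \<open>S\<close> is not in it.
  \<close>
  have nonzero_from_S: "\<exists>h\<in>Hom A S Y. h \<noteq> Null A S Y"
    if Y: "Y \<in> \<T>" "\<not> zero_object A Y" and UY: "\<And>X f. X \<in> \<U> \<Longrightarrow> f \<in> Hom A X Y \<Longrightarrow> f = Null A X Y" for Y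
  proof (rule ccontr)
    assume "\<not> ?thesis"
    then have SY: "S \<in> no_maps_to \<T> Y"
      using no_maps_toI[OF ST] by blast
    have YO: "Y \<in> Ob A"
      using tors_Ob[OF T Y(1)] .
    have "\<U> \<subseteq> no_maps_to \<T> Y"
      using no_maps_toI UY UT by blast
    moreover have "Y \<notin> no_maps_to \<T> Y"
      using no_maps_toD[OF _ Id_Hom[OF YO]] Y(2) YO by (auto simp: zero_object_iff)
    then have "no_maps_to \<T> Y \<subset> \<T>"
      using no_maps_to_subset Y(1) by blast
    ultimately have "no_maps_to \<T> Y = \<U>"
      using cover[OF no_maps_to_tors[OF T YO]] by blast
    then show False
      using SY SU by blast
  qed
  have US: "f = Null A X S" if "X \<in> \<U>" "f \<in> Hom A X S" for X f
    using no_maps_toD[OF _ that(2)] that(1) Ueq by simp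

  text \<open>
    For a shortest \<open>Y\<close> violating the claim, the kernel \<open>K\<close> admits no nonzero morphism from \<open>\<T>\<close>; hence
    none from \<open>\<U>\<close> goes to \<open>Y\<close>, so a nonzero morphism from \<open>S\<close> to \<open>Y\<close> splits \<open>g\<close>, making \<open>K\<close> a factor of \<open>Y\<close>.
  \<close>
  have kernel_epic: "K \<in> \<T>"
    if "Y \<in> \<T>" "g \<in> Hom A Y S" "epic A g" "k \<in> Hom A K Y" "is_kernel A k g" for Y g K k
    using that
  proof (induction "obj_length Y" arbitrary: Y g K k rule: less_induct)
    case less
    note Y = less.prems(1) and g = less.prems(2) and ge = less.prems(3)
      and k = less.prems(4) and kg = less.prems(5)
    have km: "monic A k"
      using kernel_monic[OF kg] .
    have gk: "g \<cdot> k = Null A K S"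
      using kernel_Null[OF kg g] k by (simp add: Hom_def)
    have KO: "K \<in> Ob A" and YO: "Y \<in> Ob A"
      using Hom_Ob[OF k] by auto
    show ?case
    proof (rule ccontr)
      assume KT: "K \<notin> \<T>"
      \<comment> \<open>The image N of a nonzero morphism would lie in T. The factor Q = Y/N is
        shorter than Y, so the kernel K' of Q -> S is in T by induction, and K is an extension of K'
        by N, against the assumption.\<close>
      have TK: "f = Null A X K" if X: "X \<in> \<T>" and f: "f \<in> Hom A X K" for X f
      proof (rule ccontr)
        assume f0: "f \<noteq> Null A X K"
        obtain N e n where e: "e \<in> Hom A X N" "epic A e" and n: "n \<in> Hom A N K" "monic A n"
          and fne: "f = n \<cdot> e"
          using image_factorization[OF f] .
        have NT: "N \<in> \<T>"
          using tors_epic[OF T e X] .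
        have N0: "\<not> zero_object A N"
        proof
          assume "zero_object A N"
          then have "e = Null A X N"
            using Hom_zero_right e(1) by blast
          then show False
            using f0 fne Comp_Null[OF n(1)] Hom_Ob[OF f] by simp
        qed
        have kn: "k \<cdot> n \<in> Hom A N Y" "monic A (k \<cdot> n)"
          using Comp_Hom[OF n(1) k] monic_Comp[OF n(2,1) km k] by auto
        obtain Q c where c: "c \<in> Hom A Y Q" "is_cokernel A c (k \<cdot> n)" "epic A c"
          using obtain_cokernel[OF kn(1)] .
        have knc: "short_exact A (k \<cdot> n) c"
          using cokernel_of_monic_short_exact[OF kn c(2)] .
        note kncD = short_exactD[OF knc kn(1) c(1)]
        have QT: "Q \<in> \<T>"
          using tors_epic[OF T c(1,3) Y] .
        have shorter: "obj_length Q < obj_length Y"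
          using obj_length_short_exact[OF knc kn(1) c(1)] obj_length_pos[OF _ N0] Hom_Ob[OF n(1)] by simp
        have "g \<cdot> (k \<cdot> n) = Null A N S"
          using Comp_assoc[OF n(1) k g] gk Null_Comp[OF n(1) SO] by simp
        then obtain g' where g': "g' \<in> Hom A Q S" "g' \<cdot> c = g"
          using short_exact_cofactor[OF knc kn(1) c(1) g] by blast
        have g'e: "epic A g'"
          using epic_Comp_left[OF _ c(1) g'(1)] g'(2) ge by simp
        obtain K' k' where k': "k' \<in> Hom A K' Q" "is_kernel A k' g'" "monic A k'" "g' \<cdot> k' = Null A K' S"
          using obtain_kernel[OF g'(1)] .
        have K'T: "K' \<in> \<T>"
          using less.hyps[OF shorter QT g'(1) g'e k'(1,2)] .
        have ck: "c \<cdot> k \<in> Hom A K Q"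
          using Comp_Hom[OF k c(1)] .
        have "g' \<cdot> (c \<cdot> k) = Null A K S"
          using Comp_assoc[OF k c(1) g'(1)] g'(2) gk by simp
        then obtain p where p: "p \<in> Hom A K K'" "k' \<cdot> p = c \<cdot> k"
          using kernel_factor[OF k'(2) g'(1) ck] k'(1) by (auto simp: Hom_def)
        have "k' \<cdot> (p \<cdot> n) = Null A N Q"
          using Comp_assoc[OF n(1) p(1) k'(1)] p(2) Comp_assoc[OF n(1) k c(1)] kncD(3) by simp
        then have pn: "p \<cdot> n = Null A N K'"
          using monic_Null[OF k'(3,1) Comp_Hom[OF n(1) p(1)]] by simp
        have n_factor: "\<exists>u\<in>Hom A W N. n \<cdot> u = h" if h: "h \<in> Hom A W K" "p \<cdot> h = Null A W K'" for W h
        proof -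
          have kh: "k \<cdot> h \<in> Hom A W Y"
            using Comp_Hom[OF h(1) k] .
          have "c \<cdot> (k \<cdot> h) = Null A W Q"
            using Comp_assoc[OF h(1) k c(1)] p(2)[symmetric] Comp_assoc[OF h(1) p(1) k'(1)] h(2)
              Comp_Null[OF k'(1)] Hom_Ob[OF h(1)] by simp
          then obtain u where u: "u \<in> Hom A W N" "(k \<cdot> n) \<cdot> u = k \<cdot> h"
            using short_exact_factor[OF knc kn(1) c(1) kh] by blast
          have "k \<cdot> (n \<cdot> u) = k \<cdot> h"
            using Comp_assoc[OF u(1) n(1) k] u(2) by simp
          then have "n \<cdot> u = h"
            using monic_cancel[OF km k Comp_Hom[OF u(1) n(1)] h(1)] by simp
          then show ?thesis
            using u(1) by blast
        qed
        obtain V w y where w: "w \<in> Hom A V K'" "epic A w" and y: "y \<in> Hom A V Y" "c \<cdot> y = k' \<cdot> w"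
          using epic_lift[OF c(1,3) k'(1)] .
        have "g \<cdot> y = Null A V S"
          using g'(2)[symmetric] Comp_assoc[OF y(1) c(1) g'(1)] y(2) Comp_assoc[OF w(1) k'(1) g'(1)]
            k'(4) Null_Comp[OF w(1) SO] by simp
        then obtain s where s: "s \<in> Hom A V K" "k \<cdot> s = y"
          using kernel_factor[OF kg g y(1)] k by (auto simp: Hom_def)
        have "k' \<cdot> (p \<cdot> s) = k' \<cdot> w"
          using Comp_assoc[OF s(1) p(1) k'(1)] p(2) Comp_assoc[OF s(1) k c(1)] s(2) y(2) by simp
        then have "p \<cdot> s = w"
          using monic_cancel[OF k'(3,1) Comp_Hom[OF s(1) p(1)] w(1)] by simp
        then have "epic A p"
          using epicI_lift[OF p(1) w s(1)] by simp
        then have "short_exact A n p"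
          using short_exactI[OF n p(1) _ pn] n_factor by blast
        then show False
          using tors_extension[OF T _ n(1) p(1) NT K'T] KT by blast
      qed
      have Y0: "\<not> zero_object A Y"
      proof
        assume "zero_object A Y"
        then have "zero_object A S"
          using epic_zero_imp[OF ge g] Hom_zero_left g by blast
        then show False
          using S by (simp add: tors_simple_def)
      qed
      have through_K: "f = Null A X Y" if X: "X \<in> \<T>" and f: "f \<in> Hom A X Y" "g \<cdot> f = Null A X S" for X f
      proof -
        obtain u where u: "u \<in> Hom A X K" "k \<cdot> u = f"
          using kernel_factor[OF kg g f] k by (auto simp: Hom_def)
        then show ?thesis
          using TK[OF X u(1)] Comp_Null[OF k] Hom_Ob[OF f(1)] by simp
      qed
      have "f = Null A X Y" if X: "X \<in> \<U>" and f: "f \<in> Hom A X Y" for X f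
        using through_K[OF _ f US[OF X Comp_Hom[OF f g]]] X UT by blast
      then obtain h where h: "h \<in> Hom A S Y" "h \<noteq> Null A S Y"
        using nonzero_from_S[OF Y Y0] by blast
      \<comment> \<open>Since h is nonzero, it does not factor through K, so g h is a nonzero
        endomorphism of S, hence epic and iso. Its inverse turns h into a section s of g.\<close>
      have gh: "g \<cdot> h \<in> Hom A S S" "g \<cdot> h \<noteq> Null A S S"
        using Comp_Hom[OF h(1) g] through_K[OF ST h(1)] h(2) by auto
      have "is_iso A (g \<cdot> h)"
        using endo_epic_iso[OF gh(1) tors_simple_epic[OF S ST gh]] .
      then obtain v where v: "v \<in> Hom A S S" "(g \<cdot> h) \<cdot> v = Id A S"
        using isoE[OF _ gh(1)] by blast
      define s where "s = h \<cdot> v"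
      have s: "s \<in> Hom A S Y" "g \<cdot> s = Id A S"
        using Comp_Hom[OF v(1) h(1)] v(2) Comp_assoc[OF v(1) h(1) g] by (auto simp: s_def)
      have sg: "s \<cdot> g \<in> Hom A Y Y"
        using Comp_Hom[OF g s(1)] .
      \<comment> \<open>The morphism d = 1 - s g is killed by g, so it factors as k r, and r is a
        retraction of k.\<close>
      obtain d where d: "d \<in> Hom A Y Y" "Id A Y = Plus A d (s \<cdot> g)"
        using ex_diff[OF Id_Hom[OF YO] sg] .
      have "g = Plus A (g \<cdot> d) g"
      proof -
        have "g = g \<cdot> Plus A d (s \<cdot> g)"
          using Comp_Id[OF g] unfolding d(2) by simp
        also have "\<dots> = Plus A (g \<cdot> d) ((g \<cdot> s) \<cdot> g)"
          unfolding Comp_Plus[OF d(1) sg g] Comp_assoc[OF g s(1) g] ..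
        also have "\<dots> = Plus A (g \<cdot> d) g"
          unfolding s(2) Id_Comp[OF g] ..
        finally show ?thesis .
      qed
      then have "g \<cdot> d = Null A Y S"
        using Plus_eq_right[OF Comp_Hom[OF d(1) g] g] by simp
      then obtain r where r: "r \<in> Hom A Y K" "k \<cdot> r = d"
        using kernel_factor[OF kg g d(1)] k by (auto simp: Hom_def)
      have "k = Plus A d (s \<cdot> g) \<cdot> k"
        using Id_Comp[OF k] unfolding d(2) by simp
      also have "\<dots> = Plus A (d \<cdot> k) (s \<cdot> (g \<cdot> k))"
        unfolding Plus_Comp[OF k d(1) sg] Comp_assoc[OF k g s(1)] ..
      also have "\<dots> = d \<cdot> k"
        unfolding gk Comp_Null[OF s(1) KO] Plus_Null[OF Comp_Hom[OF k d(1)]] ..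
      also have "\<dots> = k \<cdot> (r \<cdot> k)"
        unfolding r(2)[symmetric] Comp_assoc[OF k r(1) k] ..
      finally have "k \<cdot> (r \<cdot> k) = k \<cdot> Id A K"
        using Comp_Id[OF k] by simp
      then have "r \<cdot> k = Id A K"
        using monic_cancel[OF km k Comp_Hom[OF k r(1)] Id_Hom[OF KO]] by simp
      then have "epic A r"
        using epic_Comp_left[OF _ k r(1)] epic_Id[OF KO] by simp
      then show False
        using tors_epic[OF T r(1) _ Y] KT by blast
    qed
  qed

  have SW: "S \<in> W_L A \<T>"
  proof (rule W_LI[OF ST])
    fix Y g K k
    assume Y: "Y \<in> \<T>" and g: "g \<in> Hom A Y S" and k: "k \<in> Hom A K Y" "is_kernel A k g"
    show "K \<in> \<T>"
    proof (cases "g = Null A Y S")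
      case True
      then show ?thesis
        using kernel_of_Null_tors[OF T Y k(1) _ SO] k(2) by simp
    next
      case False
      then show ?thesis
        using kernel_epic[OF Y g _ k] tors_simple_epic[OF S Y g] by blast
    qed
  qed

  \<comment> \<open>B is not in \<open>\<U>\<close>, since otherwise its identity would vanish, so
    some nonzero f : B -> S exists, and it is epic. For a nonzero h : S -> B the composite h f is
    nonzero, hence iso as B is a brick, and f is monic too.\<close>
  have "iso_objs A B S" if B: "B \<in> right_perp A \<U> \<inter> \<T>" "brick A B" for B
  proof -
    have BT: "B \<in> \<T>" and BO: "B \<in> Ob A"
      using B tors_Ob[OF T] by auto
    have UB: "f = Null A X B" if "X \<in> \<U>" "f \<in> Hom A X B" for X f
    proof -
      have "Hom A X B = {Null A X B}"
        using B(1) that(1) by (simp add: right_perp_def)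
      then show ?thesis
        using that(2) by blast
    qed
    have B0: "\<not> zero_object A B"
      using brick_not_zero B(2) .
    have "B \<notin> \<U>"
      using UB[OF _ Id_Hom[OF BO]] B0 BO by (auto simp: zero_object_iff)
    then obtain f where f: "f \<in> Hom A B S" "f \<noteq> Null A B S"
      unfolding Ueq using no_maps_toI[OF BT] by blast
    have fe: "epic A f"
      using tors_simple_epic[OF S BT f] .
    obtain h where h: "h \<in> Hom A S B" "h \<noteq> Null A S B"
      using nonzero_from_S[OF BT B0 UB] by blast
    have "h \<cdot> f \<noteq> Null A B B"
      using epic_Null[OF fe f(1) h(1)] h(2) by blast
    then have "is_iso A (h \<cdot> f)"
      using brick_endo_iso[OF B(2) Comp_Hom[OF f(1) h(1)]] by blast
    then have "monic A f"
      using monic_Comp_right[OF _ f(1) h(1)] iso_monic Comp_Hom[OF f(1) h(1)] by blast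
    then show ?thesis
      using monic_epic_iso[OF f(1) _ fe] f(1) by (auto simp: iso_objs_def)
  qed
  moreover have "Hom A X S = {Null A X S}" if "X \<in> \<U>" for X
    using US[OF that] Null_Hom[OF tors_Ob[OF U that] SO] by blast
  then have "S \<in> right_perp A \<U>"
    using SO by (simp add: right_perp_def)
  ultimately have "is_brick_label A \<T> \<U> S"
    using H tors_simple_brick[OF S SO] ST by (simp add: is_brick_label_def)
  then show ?thesis
    using that S SW SU Ueq by blast
qed

section \<open>Generation by W_L(T) or by brick labels versus lower covers\<close>

lemma tors_gen_tors_subset:
  assumes "\<T> \<in> tors A" "\<X> \<subseteq> \<T>"
  shows "tors_gen A \<X> \<in> tors A"
proof -
  have "\<X> \<subseteq> Ob A"
    using assms tors_Ob[OF assms(1)] by blast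
  then show ?thesis
    by (rule tors_gen_tors)
qed

lemma brick_labels_subset: "brick_labels_from A \<T> \<subseteq> \<T>"
  by (auto simp: brick_labels_from_def is_brick_label_def)

lemma hasse_arrows_iff_W_L:
  assumes T: "\<T> \<in> tors A"
  shows "\<T> = tors_gen A (W_L A \<T>) \<longleftrightarrow>
    (\<forall>\<U>\<in>tors A. \<U> \<subset> \<T> \<longrightarrow> (\<exists>\<U>'. hasse_arrow A \<T> \<U>' \<and> \<U> \<subseteq> \<U>'))"
proof
  assume Teq: "\<T> = tors_gen A (W_L A \<T>)"
  show "\<forall>\<U>\<in>tors A. \<U> \<subset> \<T> \<longrightarrow> (\<exists>\<U>'. hasse_arrow A \<T> \<U>' \<and> \<U> \<subseteq> \<U>')"
  proof (intro ballI impI)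
    fix \<U>
    assume U: "\<U> \<in> tors A" "\<U> \<subset> \<T>"
    then have "\<not> W_L A \<T> \<subseteq> \<U>"
      using tors_gen_minimal[OF U(1)] Teq by blast
    then show "\<exists>\<U>'. hasse_arrow A \<T> \<U>' \<and> \<U> \<subseteq> \<U>'"
      using ex_hasse_arrow_above[OF T U(1)] U(2) by blast
  qed
next
  assume arrows: "\<forall>\<U>\<in>tors A. \<U> \<subset> \<T> \<longrightarrow> (\<exists>\<U>'. hasse_arrow A \<T> \<U>' \<and> \<U> \<subseteq> \<U>')"
  let ?U = "tors_gen A (W_L A \<T>)"
  have U: "?U \<in> tors A" "?U \<subseteq> \<T>"
    using tors_gen_tors_subset[OF T W_L_subset] tors_gen_minimal[OF T W_L_subset] by auto
  show "\<T> = ?U"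
  proof (rule ccontr)
    assume "\<T> \<noteq> ?U"
    then obtain \<U>' where U': "hasse_arrow A \<T> \<U>'" "?U \<subseteq> \<U>'"
      using arrows U by blast
    obtain S where "S \<in> W_L A \<T>" "S \<notin> \<U>'"
      by (rule hasse_arrow_label[OF U'(1)])
    then show False
      using tors_gen_subset U'(2) by blast
  qed
qed

lemma hasse_arrows_iff_brick_labels:
  assumes T: "\<T> \<in> tors A"
  shows "\<T> = tors_gen A (brick_labels_from A \<T>) \<longleftrightarrow>
    (\<forall>\<U>\<in>tors A. \<U> \<subset> \<T> \<longrightarrow> (\<exists>\<U>'. hasse_arrow A \<T> \<U>' \<and> \<U> \<subseteq> \<U>'))"
proof
  assume Teq: "\<T> = tors_gen A (brick_labels_from A \<T>)"
  show "\<forall>\<U>\<in>tors A. \<U> \<subset> \<T> \<longrightarrow> (\<exists>\<U>'. hasse_arrow A \<T> \<U>' \<and> \<U> \<subseteq> \<U>')"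
  proof (intro ballI impI)
    fix \<U>
    assume U: "\<U> \<in> tors A" "\<U> \<subset> \<T>"
    then have "\<not> brick_labels_from A \<T> \<subseteq> \<U>"
      using tors_gen_minimal[OF U(1)] Teq by blast
    then obtain B \<U>' where B: "B \<notin> \<U>" and label: "is_brick_label A \<T> \<U>' B"
      unfolding brick_labels_from_def by blast
    have H: "hasse_arrow A \<T> \<U>'"
      using label by (simp add: is_brick_label_def)
    obtain S where S: "tors_simple \<T> S" "\<U>' = no_maps_to \<T> S" "is_brick_label A \<T> \<U>' S"
      by (rule hasse_arrow_label[OF H])
    \<comment> \<open>A label is determined only up to isomorphism: B is exchanged for an S that is
      simple relative to T, and S is outside \<open>\<U>\<close> because B is a factor of S.\<close>
    have "iso_objs A S B"
      using label S(3) unfolding is_brick_label_def by blast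
    then obtain f where "f \<in> Hom A S B" "epic A f"
      using iso_objs_epic by blast
    then have "S \<notin> \<U>"
      using tors_epic[OF U(1)] B by blast
    then have "\<U> \<subseteq> \<U>'"
      using subset_no_maps_to[OF S(1) U(1)] U(2) S(2) by blast
    then show "\<exists>\<U>'. hasse_arrow A \<T> \<U>' \<and> \<U> \<subseteq> \<U>'"
      using H by blast
  qed
next
  assume arrows: "\<forall>\<U>\<in>tors A. \<U> \<subset> \<T> \<longrightarrow> (\<exists>\<U>'. hasse_arrow A \<T> \<U>' \<and> \<U> \<subseteq> \<U>')"
  let ?U = "tors_gen A (brick_labels_from A \<T>)"
  have U: "?U \<in> tors A" "?U \<subseteq> \<T>"
    using tors_gen_tors_subset[OF T brick_labels_subset] tors_gen_minimal[OF T brick_labels_subset] by auto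
  show "\<T> = ?U"
  proof (rule ccontr)
    assume "\<T> \<noteq> ?U"
    then obtain \<U>' where U': "hasse_arrow A \<T> \<U>'" "?U \<subseteq> \<U>'"
      using arrows U by blast
    obtain S where "is_brick_label A \<T> \<U>' S" "S \<notin> \<U>'"
      by (rule hasse_arrow_label[OF U'(1)])
    then have "S \<in> brick_labels_from A \<T>" "S \<notin> \<U>'"
      unfolding brick_labels_from_def by blast+
    then show False
      using tors_gen_subset U'(2) by blast
  qed
qed

end

theorem theorem1p8:
  fixes A :: "('o, 'm, 'e) precat_scheme" and \<T> :: "'o set"
  assumes "abelian_length_category A" and "\<T> \<in> tors A"
  shows "(widely_generated A \<T> \<longleftrightarrow> \<T> = tors_gen A (W_L A \<T>))
    \<and> (\<T> = tors_gen A (W_L A \<T>) \<longleftrightarrow> \<T> = tors_gen A (brick_labels_from A \<T>))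
    \<and> (\<T> = tors_gen A (brick_labels_from A \<T>) \<longleftrightarrow>
        (\<forall>\<U>\<in>tors A. \<U> \<subset> \<T> \<longrightarrow> (\<exists>\<U>'. hasse_arrow A \<T> \<U>' \<and> \<U> \<subseteq> \<U>')))"
proof -
  interpret abelian_length_category A
    by fact
  show ?thesis
    using widely_generated_iff[OF assms(2)] hasse_arrows_iff_W_L[OF assms(2)]
      hasse_arrows_iff_brick_labels[OF assms(2)] by argo
qed

end
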